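(* Let $N\in\mathbb{N}$, $R>0$ and $h_0\in(\mathcal{A}_R^{(N)})^{sa}$. (1) There exists an equilibrium tracial state $\mu_0\in\mathcal{T}(\mathcal{A}_R^{(N)})$ associated with $h_0$ such that $$\liminf_{n\to\infty}\Bigl(\frac1{n^2}S(\lambda_{R,n}^{h_0})+\frac N2\log n\Bigr)\le\eta_R(\mu_0)\le\limsup_{n\to\infty}\Bigl(\frac1{n^2}S(\lambda_{R,n}^{h_0})+\frac N2\log n\Bigr).$$ (2) Assume that the limit $$\pi_R(h_0)=\lim_{n\to\infty}\Bigl(\frac1{n^2}P_{R,n}(h_0)+\frac N2\log n\Bigr)$$ exists. Then any limit point of the sequence $\bigl\{\frac1{n^2}S(\lambda_{R,n}^{h_0})+\frac N2\log n\bigr\}$ is attained as the value $\eta_R(\mu_0)$ of some equilibrium tracial state $\mu_0$ associated with $h_0$. In particular, if $\mu_0$ is a unique equilibrium tracial state associated with $h_0$, then $$\eta_R(\mu_0)=\lim_{n\to\infty}\Bigl(\frac1{n^2}S(\lambda_{R,n}^{h_0})+\frac N2\log n\Bigr).$$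
   Context: $M_n$ is the algebra of $n\times n$ complex matrices, $M_n^{sa}$ its selfadjoint part, $\mathrm{tr}_n$ the normalized trace, $\|\cdot\|$ the operator norm, $(M_n^{sa})_R:=\{A\in M_n^{sa}:\|A\|\le R\}$ and $(M_n^{sa})_R^N$ its $N$-fold Cartesian product. $\Lambda_n$ is the measure $d\Lambda_n(A):=2^{n(n-1)/2}\prod_{i=1}^n dA_{ii}\prod_{i<j}d(\mathrm{Re}\,A_{ij})\,d(\mathrm{Im}\,A_{ij})$ on $M_n^{sa}$, and $\Lambda_n^{\otimes N}$ is its $N$-fold product. $\mathbb{C}\langle X_1,\dots,X_N\rangle$ is the noncommutative polynomial $*$-algebra with $X_i^*=X_i$. For $R>0$ put $\|p\|_R:=\sup\{\|p(A_1,\dots,A_N)\|: A_i\in M_n^{sa},\ \|A_i\|\le R,\ n\in\mathbb{N}\}$, a $C^*$-norm, and let $\mathcal{A}_R^{(N)}$ be the corresponding $C^*$-completion (the $N$-fold full free product of $C([-R,R])$), with selfadjoint part $(\mathcal{A}_R^{(N)})^{sa}$. For selfadjoint $a_1,\dots,a_N\in B(\mathcal{H})$ with $\|a_i\|\le R$, the map $p\mapsto p(a_1,\dots,a_N)$ extends to a $*$-homomorphism $h\in\mathcal{A}_R^{(N)}\mapsto h(a_1,\dots,a_N)\in B(\mathcal{H})$. $\mathcal{T}(\mathcal{A}_R^{(N)})$ is the set of tracial states on $\mathcal{A}_R^{(N)}$. For $h\in(\mathcal{A}_R^{(N)})^{sa}$, $$P_{R,n}(h):=\log\int_{(M_n^{sa})_R^N}\exp\bigl(-n^2\mathrm{tr}_n(h(A_1,\dots,A_N))\bigr)\,d\Lambda_n^{\otimes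 N}(A_1,\dots,A_N),$$ the free pressure is $\pi_R(h):=\limsup_{n\to\infty}\bigl(\frac1{n^2}P_{R,n}(h)+\frac N2\log n\bigr)$, and for $\mu\in\mathcal{T}(\mathcal{A}_R^{(N)})$, $\eta_R(\mu):=\inf\{\mu(p)+\pi_R(p):p\in\mathbb{C}\langle X_1,\dots,X_N\rangle^{sa}\}$, which equals $\inf\{\mu(h)+\pi_R(h):h\in(\mathcal{A}_R^{(N)})^{sa}\}$. An equilibrium tracial state associated with $h_0$ is a $\mu_0\in\mathcal{T}(\mathcal{A}_R^{(N)})$ with $\pi_R(h_0)=-\mu_0(h_0)+\eta_R(\mu_0)$. The Gibbs probability measure $\lambda_{R,n}^{h_0}$ on $(M_n^{sa})_R^N$ has density $\exp(-P_{R,n}(h_0))\exp\bigl(-n^2\mathrm{tr}_n(h_0(A_1,\dots,A_N))\bigr)$ with respect to $\Lambda_n^{\otimes N}$ restricted to $(M_n^{sa})_R^N$. Its Boltzmann–Gibbs entropy is $$S(\lambda_{R,n}^{h_0}):=-\int_{(M_n^{sa})_R^N}\frac{d\lambda_{R,n}^{h_0}}{d\Lambda_n^{\otimes N}}\log\frac{d\lambda_{R,n}^{h_0}}{d\Lambda_n^{\otimes N}}\,d\Lambda_n^{\otimes N}.$$ *)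

theory Defs
  imports
    "HOL-Analysis.Finite_Product_Measure"
    "HOL-Analysis.Lebesgue_Measure"
    "HOL-Analysis.Radon_Nikodym"
    "HOL-Analysis.L2_Norm"
    "HOL-Library.Poly_Mapping"
    "Jordan_Normal_Form.Schur_Decomposition"
begin

section \<open>Selfadjoint matrices\<close>

definition op_norm :: "complex mat \<Rightarrow> real" where
  "op_norm A =
     (let l2 = (\<lambda>v. L2_set (\<lambda>i. cmod (vec_index v i)) {..<dim_vec v})
      in SUP v \<in> {v \<in> carrier_vec (dim_col A). l2 v \<le> 1}. l2 (A *\<^sub>v v))"

definition ntr :: "complex mat \<Rightarrow> complex" where
  "ntr A = (\<Sum>i<dim_row A. A $$ (i, i)) / of_nat (dim_row A)"

definition sa_mats :: "nat \<Rightarrow> complex mat set" where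
  "sa_mats n = {A \<in> carrier_mat n n. mat_adjoint A = A}"

text \<open>Tuples are extensional functions on the index set \<open>{..<N}\<close>.\<close>

definition sa_balls :: "nat \<Rightarrow> real \<Rightarrow> nat \<Rightarrow> (nat \<Rightarrow> complex mat) set" where
  "sa_balls N R n = (\<Pi>\<^sub>E i\<in>{..<N}. {A \<in> sa_mats n. op_norm A \<le> R})"

definition sa_borel :: "nat \<Rightarrow> complex mat measure" where
  "sa_borel n = sigma (sa_mats n)
     {{A \<in> sa_mats n. A $$ (i, j) \<in> B} | i j B. i < n \<and> j < n \<and> B \<in> sets borel}"

text \<open>Real coordinates of a selfadjoint matrix: \<open>f (i, i)\<close> is the \<open>i\<close>-th diagonal entry; for
  \<open>i < j\<close>, \<open>f (i, j)\<close> and \<open>f (j, i)\<close> are the real and the imaginary part of the entry \<open>(i, j)\<close>.\<close>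

definition sa_of_coords :: "nat \<Rightarrow> (nat \<times> nat \<Rightarrow> real) \<Rightarrow> complex mat" where
  "sa_of_coords n f = Matrix.mat n n (\<lambda>(i, j).
     if i = j then complex_of_real (f (i, i))
     else if i < j then Complex (f (i, j)) (f (j, i))
     else Complex (f (j, i)) (- f (i, j)))"

definition Lambda :: "nat \<Rightarrow> complex mat measure" where
  "Lambda n = distr
     (scale_measure (2 ^ (n * (n - 1) div 2)) (PiM ({..<n} \<times> {..<n}) (\<lambda>_. lborel)))
     (sa_borel n) (sa_of_coords n)"

text \<open>The restriction of the \<open>N\<close>-fold product of \<open>Lambda n\<close> to tuples of norm at most \<open>R\<close>.\<close>

definition Lambda_ball :: "nat \<Rightarrow> real \<Rightarrow> nat \<Rightarrow> (nat \<Rightarrow> complex mat) measure" where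
  "Lambda_ball N R n = restrict_space (PiM {..<N} (\<lambda>_. Lambda n)) (sa_balls N R n)"

section \<open>Noncommutative polynomials and their C*-completion\<close>

text \<open>A noncommutative polynomial is a finitely supported coefficient function on words; the
  letters \<open>0, \<dots>, N - 1\<close> stand for \<open>X\<^sub>1, \<dots>, X\<^sub>N\<close>. As \<open>X\<^sub>i\<close> is selfadjoint, the involution
  reverses words and conjugates coefficients.\<close>

type_synonym ncpoly = "nat list \<Rightarrow>\<^sub>0 complex"

definition ncpolys :: "nat \<Rightarrow> ncpoly set" where
  "ncpolys N = {p. Poly_Mapping.keys p \<subseteq> lists {..<N}}"

definition ncpolys_sa :: "nat \<Rightarrow> ncpoly set" where
  "ncpolys_sa N = {p \<in> ncpolys N.
     \<forall>w. Poly_Mapping.lookup p (rev w) = cnj (Poly_Mapping.lookup p w)}"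

definition eval_word :: "nat \<Rightarrow> (nat \<Rightarrow> complex mat) \<Rightarrow> nat list \<Rightarrow> complex mat" where
  "eval_word n A w = foldr (\<lambda>i M. A i * M) w (1\<^sub>m n)"

definition eval_poly :: "nat \<Rightarrow> (nat \<Rightarrow> complex mat) \<Rightarrow> ncpoly \<Rightarrow> complex mat" where
  "eval_poly n A p = Matrix.mat n n (\<lambda>ij.
     \<Sum>w\<in>Poly_Mapping.keys p. Poly_Mapping.lookup p w * eval_word n A w $$ ij)"

text \<open>The norm \<open>\<parallel>p\<parallel>\<^sub>R\<close> is the supremum norm of the matrix-valued function \<open>(n, A) \<mapsto> p(A)\<close> on
  \<open>eval_dom N R\<close>. Therefore the completion of the polynomials is realised as their closure
  for that norm among all functions that assign an \<open>n \<times> n\<close> matrix to each point \<open>(n, A)\<close>, with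
  pointwise operations, and \<open>h(A\<^sub>1, \<dots>, A\<^sub>N)\<close> is the value \<open>h (n, A)\<close>. The norm is \<open>ereal\<close>-valued
  since it is also applied to functions that are not known to be bounded.\<close>

type_synonym ncfun = "nat \<times> (nat \<Rightarrow> complex mat) \<Rightarrow> complex mat"

definition eval_dom :: "nat \<Rightarrow> real \<Rightarrow> (nat \<times> (nat \<Rightarrow> complex mat)) set" where
  "eval_dom N R = (SIGMA n:{1..}. sa_balls N R n)"

definition of_poly :: "nat \<Rightarrow> real \<Rightarrow> ncpoly \<Rightarrow> ncfun" where
  "of_poly N R p = (\<lambda>(n, A) \<in> eval_dom N R. eval_poly n A p)"

definition nc_norm :: "nat \<Rightarrow> real \<Rightarrow> ncfun \<Rightarrow> ereal" where
  "nc_norm N R f = (SUP x \<in> eval_dom N R. ereal (op_norm (f x)))"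

definition nc_one :: "nat \<Rightarrow> real \<Rightarrow> ncfun" where
  "nc_one N R = (\<lambda>(n, A) \<in> eval_dom N R. 1\<^sub>m n)"

definition nc_add :: "nat \<Rightarrow> real \<Rightarrow> ncfun \<Rightarrow> ncfun \<Rightarrow> ncfun" where
  "nc_add N R f g = (\<lambda>x \<in> eval_dom N R. f x + g x)"

definition nc_diff :: "nat \<Rightarrow> real \<Rightarrow> ncfun \<Rightarrow> ncfun \<Rightarrow> ncfun" where
  "nc_diff N R f g = (\<lambda>x \<in> eval_dom N R. f x - g x)"

definition nc_scale :: "nat \<Rightarrow> real \<Rightarrow> complex \<Rightarrow> ncfun \<Rightarrow> ncfun" where
  "nc_scale N R c f = (\<lambda>x \<in> eval_dom N R. c \<cdot>\<^sub>m f x)"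

definition nc_mult :: "nat \<Rightarrow> real \<Rightarrow> ncfun \<Rightarrow> ncfun \<Rightarrow> ncfun" where
  "nc_mult N R f g = (\<lambda>x \<in> eval_dom N R. f x * g x)"

definition nc_star :: "nat \<Rightarrow> real \<Rightarrow> ncfun \<Rightarrow> ncfun" where
  "nc_star N R f = (\<lambda>x \<in> eval_dom N R. mat_adjoint (f x))"

definition nc_alg :: "nat \<Rightarrow> real \<Rightarrow> ncfun set" where
  "nc_alg N R = {h \<in> (\<Pi>\<^sub>E (n, A)\<in>eval_dom N R. carrier_mat n n).
     \<forall>\<epsilon>>0. \<exists>p\<in>ncpolys N. nc_norm N R (nc_diff N R h (of_poly N R p)) < ereal \<epsilon>}"

definition nc_alg_sa :: "nat \<Rightarrow> real \<Rightarrow> ncfun set" where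
  "nc_alg_sa N R = {h \<in> nc_alg N R. nc_star N R h = h}"

text \<open>States are extensional on \<open>nc_alg N R\<close>, so that equality of states is equality of
  functions.\<close>

definition tracial_states :: "nat \<Rightarrow> real \<Rightarrow> (ncfun \<Rightarrow> complex) set" where
  "tracial_states N R = {\<mu> \<in> extensional (nc_alg N R).
     (\<forall>a\<in>nc_alg N R. \<forall>b\<in>nc_alg N R. \<mu> (nc_add N R a b) = \<mu> a + \<mu> b) \<and>
     (\<forall>c. \<forall>a\<in>nc_alg N R. \<mu> (nc_scale N R c a) = c * \<mu> a) \<and>
     (\<forall>a\<in>nc_alg N R. \<mu> (nc_mult N R (nc_star N R a) a) \<in> \<real> \<and>
        0 \<le> Re (\<mu> (nc_mult N R (nc_star N R a) a))) \<and>
     \<mu> (nc_one N R) = 1 \<and>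
     (\<forall>a\<in>nc_alg N R. \<forall>b\<in>nc_alg N R. \<mu> (nc_mult N R a b) = \<mu> (nc_mult N R b a))}"

section \<open>Free pressure, its Legendre transform and equilibrium\<close>

text \<open>For selfadjoint \<open>h\<close> the numbers \<open>ntr (h (n, A))\<close> and \<open>\<mu> h\<close> are real; \<open>Re\<close> below only
  changes the type.\<close>

definition gibbs_weight :: "ncfun \<Rightarrow> nat \<Rightarrow> (nat \<Rightarrow> complex mat) \<Rightarrow> real" where
  "gibbs_weight h n A = exp (- (real n)\<^sup>2 * Re (ntr (h (n, A))))"

definition pressure :: "nat \<Rightarrow> real \<Rightarrow> nat \<Rightarrow> ncfun \<Rightarrow> real" where
  "pressure N R n h = ln (LINT A|Lambda_ball N R n. gibbs_weight h n A)"

definition pressure_seq :: "nat \<Rightarrow> real \<Rightarrow> ncfun \<Rightarrow> nat \<Rightarrow> real" where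
  "pressure_seq N R h n = pressure N R n h / (real n)\<^sup>2 + real N / 2 * ln (real n)"

definition free_pressure :: "nat \<Rightarrow> real \<Rightarrow> ncfun \<Rightarrow> ereal" where
  "free_pressure N R h = limsup (\<lambda>n. ereal (pressure_seq N R h n))"

definition eta :: "nat \<Rightarrow> real \<Rightarrow> (ncfun \<Rightarrow> complex) \<Rightarrow> ereal" where
  "eta N R \<mu> = (INF p \<in> ncpolys_sa N.
     ereal (Re (\<mu> (of_poly N R p))) + free_pressure N R (of_poly N R p))"

definition equilibrium_states :: "nat \<Rightarrow> real \<Rightarrow> ncfun \<Rightarrow> (ncfun \<Rightarrow> complex) set" where
  "equilibrium_states N R h = {\<mu> \<in> tracial_states N R.
     free_pressure N R h = - ereal (Re (\<mu> h)) + eta N R \<mu>}"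

section \<open>Gibbs measures and their entropy\<close>

definition gibbs :: "nat \<Rightarrow> real \<Rightarrow> nat \<Rightarrow> ncfun \<Rightarrow> (nat \<Rightarrow> complex mat) measure" where
  "gibbs N R n h = density (Lambda_ball N R n)
     (\<lambda>A. ennreal (exp (- pressure N R n h) * gibbs_weight h n A))"

definition bg_entropy :: "'a measure \<Rightarrow> 'a measure \<Rightarrow> real" where
  "bg_entropy M P =
     - (LINT x|M. enn2real (RN_deriv M P x) * ln (enn2real (RN_deriv M P x)))"

definition entropy_seq :: "nat \<Rightarrow> real \<Rightarrow> ncfun \<Rightarrow> nat \<Rightarrow> real" where
  "entropy_seq N R h n =
     bg_entropy (Lambda_ball N R n) (gibbs N R n h) / (real n)\<^sup>2 + real N / 2 * ln (real n)"

end

theory Submission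
  imports Defs
begin

text \<open>Let \<open>\<mu>\<^sub>n\<close> be the tracial state that averages the normalized trace over the Gibbs measure of
  \<open>h\<^sub>0\<close>. The normalized entropy of that measure is the normalized pressure of \<open>h\<^sub>0\<close> plus \<open>\<mu>\<^sub>n(h\<^sub>0)\<close>,
  and Jensen's inequality bounds this sum by the pressure of any \<open>p\<close> plus \<open>\<mu>\<^sub>n(p)\<close>. Take a
  subsequence along which the pressure of \<open>h\<^sub>0\<close> converges to the free pressure. By Tychonoff's theorem
  the \<open>\<mu>\<^sub>n\<close> converge pointwise to a tracial state \<open>\<mu>\<close> along a finer filter, and in the limit
  \<open>\<pi>(h\<^sub>0) + \<mu>(h\<^sub>0) \<le> \<pi>(p) + \<mu>(p)\<close> for every \<open>p\<close>. Approximating \<open>h\<^sub>0\<close> by polynomials turns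
  this into \<open>\<eta>(\<mu>) = \<pi>(h\<^sub>0) + \<mu>(h\<^sub>0)\<close>. So \<open>\<mu>\<close> is an equilibrium state, and the normalized
  entropies tend to \<open>\<eta>(\<mu>)\<close> along that filter.\<close>

section \<open>Operator norm and normalized trace\<close>

text \<open>A single inequality between finite-dimensional pressures carries the limit argument.
  Passed to the limit it bounds \<open>eta\<close> from below; applied to the Gibbs state of a
  perturbed function it shows that the free pressure is Lipschitz for the norm. The second use is
  forced because the infimum in \<open>eta\<close> ranges over polynomials, so
  \<open>h\<^sub>0\<close> itself need not compete. The free pressure is only a limsup: in the lower
  bound the pressures of \<open>h\<^sub>0\<close> stand on the smaller side and have to converge to
  it, while those of a competitor need only be bounded by their limsup; hence the subsequence. When
  the pressures converge outright, any subsequence will do, and it can be chosen to suit the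
  entropies: this is the difference between the two claims. States are points of a product indexed
  by the whole algebra, where a sequence need not have a convergent subsequence. A filter finer than
  \<open>sequentially\<close> takes its place at no cost: it keeps every limit of the sequence, and
  its own limits lie between liminf and limsup.\<close>

definition vnorm :: "complex vec \<Rightarrow> real" where
  "vnorm v = L2_set (\<lambda>i. cmod (vec_index v i)) {..<dim_vec v}"

lemma op_norm_vnorm:
  "op_norm A = (SUP v \<in> {v \<in> carrier_vec (dim_col A). vnorm v \<le> 1}. vnorm (A *\<^sub>v v))"
  by (simp add: op_norm_def vnorm_def Let_def)

lemma index_mult_mat_vec_sum:
  assumes "A \<in> carrier_mat n m" "v \<in> carrier_vec m" "i < n"
  shows "(A *\<^sub>v v) $ i = (\<Sum>j<m. A $$ (i, j) * v $ j)"
  using assms by (auto simp: scalar_prod_def atLeast0LessThan intro!: sum.cong)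

lemma index_mult_mat_sum:
  assumes "A \<in> carrier_mat n m" "B \<in> carrier_mat m k" "i < n" "j < k"
  shows "(A * B) $$ (i, j) = (\<Sum>l<m. A $$ (i, l) * B $$ (l, j))"
  using assms by (auto simp: scalar_prod_def atLeast0LessThan intro!: sum.cong)

lemma mat_adjoint_carrier:
  assumes "A \<in> carrier_mat n m"
  shows "mat_adjoint A \<in> carrier_mat m n"
  using assms by (auto simp: mat_adjoint_def)

lemma index_mat_adjoint:
  fixes A :: "complex mat"
  assumes "A \<in> carrier_mat n m" "i < m" "j < n"
  shows "mat_adjoint A $$ (i, j) = cnj (A $$ (j, i))"
  using assms by (auto simp: mat_adjoint_def mat_of_rows_def)

lemma vnorm_nonneg: "0 \<le> vnorm v"
  by (simp add: vnorm_def)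

lemma vnorm_triangle:
  assumes "u \<in> carrier_vec n" "v \<in> carrier_vec n"
  shows "vnorm (u + v) \<le> vnorm u + vnorm v"
proof -
  have "vnorm (u + v) \<le> L2_set (\<lambda>i. cmod (u $ i) + cmod (v $ i)) {..<n}"
    unfolding vnorm_def using assms by (auto intro!: L2_set_mono norm_triangle_ineq)
  also have "\<dots> \<le> vnorm u + vnorm v"
    unfolding vnorm_def using assms L2_set_triangle_ineq by fastforce
  finally show ?thesis .
qed

lemma vnorm_smult: "vnorm (c \<cdot>\<^sub>v v) = cmod c * vnorm v"
proof -
  have "vnorm (c \<cdot>\<^sub>v v) = L2_set (\<lambda>i. cmod c * cmod (v $ i)) {..<dim_vec v}"
    unfolding vnorm_def by (auto simp: norm_mult intro!: L2_set_cong)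
  then show ?thesis
    by (simp add: vnorm_def L2_set_right_distrib)
qed

lemma component_le_vnorm: "i < dim_vec v \<Longrightarrow> cmod (v $ i) \<le> vnorm v"
  unfolding vnorm_def by (rule member_le_L2_set) auto

lemma vnorm_le_sum: "vnorm v \<le> (\<Sum>i<dim_vec v. cmod (v $ i))"
  unfolding vnorm_def by (rule L2_set_le_sum) auto

lemma vnorm_zero [simp]: "vnorm (0\<^sub>v n) = 0"
  by (simp add: vnorm_def L2_set_def)

lemma vnorm_eq_0D:
  assumes "vnorm v = 0"
  shows "v = 0\<^sub>v (dim_vec v)"
  using assms by (intro eq_vecI) (auto simp: vnorm_def L2_set_eq_0_iff)

lemma sum_mult_le_vnorm:
  assumes "u \<in> carrier_vec n" "v \<in> carrier_vec n"
  shows "cmod (\<Sum>i<n. u $ i * v $ i) \<le> vnorm u * vnorm v"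
proof -
  have "cmod (\<Sum>i<n. u $ i * v $ i) \<le> (\<Sum>i<n. \<bar>cmod (u $ i)\<bar> * \<bar>cmod (v $ i)\<bar>)"
    by (rule order_trans[OF norm_sum]) (simp add: norm_mult)
  also have "\<dots> \<le> vnorm u * vnorm v"
    using assms L2_set_mult_ineq[of "\<lambda>i. cmod (u $ i)" "\<lambda>i. cmod (v $ i)" "{..<n}"]
    by (simp add: vnorm_def)
  finally show ?thesis .
qed

text \<open>A crude bound comes first because a real supremum carries no information until its set
  is known to be bounded above. The same bound later fits a box of matrices with small entries into
  an operator norm ball.\<close>

lemma vnorm_mult_mat_vec_le_sum:
  assumes A: "A \<in> carrier_mat n m" and v: "v \<in> carrier_vec m"
  shows "vnorm (A *\<^sub>v v) \<le> (\<Sum>i<n. \<Sum>j<m. cmod (A $$ (i, j))) * vnorm v"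
proof -
  have "vnorm (A *\<^sub>v v) \<le> (\<Sum>i<n. cmod ((A *\<^sub>v v) $ i))"
    using vnorm_le_sum[of "A *\<^sub>v v"] A by simp
  also have "\<dots> \<le> (\<Sum>i<n. \<Sum>j<m. cmod (A $$ (i, j)) * vnorm v)"
  proof (rule sum_mono)
    fix i assume "i \<in> {..<n}"
    then have "cmod ((A *\<^sub>v v) $ i) \<le> (\<Sum>j<m. cmod (A $$ (i, j) * v $ j))"
      using index_mult_mat_vec_sum[OF A v] by (simp add: norm_sum)
    also have "\<dots> \<le> (\<Sum>j<m. cmod (A $$ (i, j)) * vnorm v)"
      using v component_le_vnorm[of _ v]
      by (intro sum_mono) (auto simp: norm_mult intro!: mult_left_mono)
    finally show "cmod ((A *\<^sub>v v) $ i) \<le> (\<Sum>j<m. cmod (A $$ (i, j)) * vnorm v)" .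
  qed
  finally show ?thesis by (simp add: sum_distrib_right)
qed

section \<open>The operator norm as a submultiplicative norm\<close>

lemma op_norm_bdd:
  "bdd_above ((\<lambda>v. vnorm (A *\<^sub>v v)) ` {v \<in> carrier_vec (dim_col A). vnorm v \<le> 1})"
proof (rule bdd_aboveI2)
  fix v assume v: "v \<in> {v \<in> carrier_vec (dim_col A). vnorm v \<le> 1}"
  let ?s = "\<Sum>i<dim_row A. \<Sum>j<dim_col A. cmod (A $$ (i, j))"
  have "vnorm (A *\<^sub>v v) \<le> ?s * vnorm v"
    using v by (intro vnorm_mult_mat_vec_le_sum) auto
  also have "\<dots> \<le> ?s * 1"
    using v by (intro mult_left_mono sum_nonneg) auto
  finally show "vnorm (A *\<^sub>v v) \<le> ?s * 1" .
qed

lemma op_norm_nonneg: "0 \<le> op_norm A"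
proof -
  have "vnorm (A *\<^sub>v 0\<^sub>v (dim_col A)) \<le> op_norm A"
    unfolding op_norm_vnorm by (rule cSUP_upper[OF _ op_norm_bdd]) auto
  then show ?thesis
    using vnorm_nonneg order_trans by blast
qed

lemma vnorm_mult_mat_vec_le:
  assumes v: "v \<in> carrier_vec (dim_col A)"
  shows "vnorm (A *\<^sub>v v) \<le> op_norm A * vnorm v"
proof (cases "vnorm v = 0")
  case True
  then have "v = 0\<^sub>v (dim_col A)"
    using vnorm_eq_0D[of v] v by simp
  then have "A *\<^sub>v v = 0\<^sub>v (dim_row A)"
    by (auto intro!: eq_vecI)
  then show ?thesis using True by simp
next
  case False
  then have pos: "vnorm v > 0" using vnorm_nonneg[of v] by simp
  define w where "w = complex_of_real (1 / vnorm v) \<cdot>\<^sub>v v"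
  have "vnorm (A *\<^sub>v w) \<le> op_norm A"
    unfolding op_norm_vnorm using v pos
    by (intro cSUP_upper[OF _ op_norm_bdd]) (auto simp: w_def vnorm_smult norm_divide)
  moreover have "A *\<^sub>v w = complex_of_real (1 / vnorm v) \<cdot>\<^sub>v (A *\<^sub>v v)"
    unfolding w_def by (rule mult_mat_vec[OF _ v]) auto
  ultimately show ?thesis
    using pos by (simp add: vnorm_smult norm_divide field_simps)
qed

lemma op_norm_le:
  assumes "\<And>v. v \<in> carrier_vec (dim_col A) \<Longrightarrow> vnorm (A *\<^sub>v v) \<le> c * vnorm v" and "0 \<le> c"
  shows "op_norm A \<le> c"
  unfolding op_norm_vnorm
proof (rule cSUP_least)
  show "{v \<in> carrier_vec (dim_col A). vnorm v \<le> 1} \<noteq> {}"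
    using vnorm_zero[of "dim_col A"] by (auto intro!: exI[of _ "0\<^sub>v (dim_col A)"])
  fix v assume v: "v \<in> {v \<in> carrier_vec (dim_col A). vnorm v \<le> 1}"
  then have "vnorm (A *\<^sub>v v) \<le> c * vnorm v" using assms by auto
  also have "\<dots> \<le> c * 1" using v assms by (intro mult_left_mono) auto
  finally show "vnorm (A *\<^sub>v v) \<le> c" by simp
qed

lemma op_norm_le_sum:
  assumes "A \<in> carrier_mat n m"
  shows "op_norm A \<le> (\<Sum>i<n. \<Sum>j<m. cmod (A $$ (i, j)))"
  using assms by (intro op_norm_le vnorm_mult_mat_vec_le_sum sum_nonneg) auto

lemma op_norm_add:
  assumes "A \<in> carrier_mat n m" "B \<in> carrier_mat n m"
  shows "op_norm (A + B) \<le> op_norm A + op_norm B"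
proof (rule op_norm_le)
  fix v :: "complex vec" assume "v \<in> carrier_vec (dim_col (A + B))"
  then have v: "v \<in> carrier_vec m" using assms by simp
  have "vnorm ((A + B) *\<^sub>v v) = vnorm (A *\<^sub>v v + B *\<^sub>v v)"
    using add_mult_distrib_mat_vec[OF assms v] by simp
  also have "\<dots> \<le> vnorm (A *\<^sub>v v) + vnorm (B *\<^sub>v v)"
    using assms v by (intro vnorm_triangle[of _ n]) auto
  also have "\<dots> \<le> op_norm A * vnorm v + op_norm B * vnorm v"
    using assms v by (intro add_mono vnorm_mult_mat_vec_le) auto
  finally show "vnorm ((A + B) *\<^sub>v v) \<le> (op_norm A + op_norm B) * vnorm v"
    by (simp add: algebra_simps)
qed (simp add: op_norm_nonneg)

lemma op_norm_smult: "op_norm (c \<cdot>\<^sub>m A) \<le> cmod c * op_norm A"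
proof (rule op_norm_le)
  fix v :: "complex vec" assume "v \<in> carrier_vec (dim_col (c \<cdot>\<^sub>m A))"
  then have v: "v \<in> carrier_vec (dim_col A)" by simp
  have "(c \<cdot>\<^sub>m A) *\<^sub>v v = c \<cdot>\<^sub>v (A *\<^sub>v v)"
    using v by (intro eq_vecI) auto
  then have "vnorm ((c \<cdot>\<^sub>m A) *\<^sub>v v) = cmod c * vnorm (A *\<^sub>v v)"
    by (simp add: vnorm_smult)
  also have "\<dots> \<le> cmod c * (op_norm A * vnorm v)"
    using v by (intro mult_left_mono vnorm_mult_mat_vec_le) auto
  finally show "vnorm ((c \<cdot>\<^sub>m A) *\<^sub>v v) \<le> cmod c * op_norm A * vnorm v"
    by (simp add: mult.assoc)
qed (simp add: op_norm_nonneg)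

lemma op_norm_mult:
  assumes "A \<in> carrier_mat n m" "B \<in> carrier_mat m k"
  shows "op_norm (A * B) \<le> op_norm A * op_norm B"
proof (rule op_norm_le)
  fix v :: "complex vec" assume "v \<in> carrier_vec (dim_col (A * B))"
  then have v: "v \<in> carrier_vec k" using assms by simp
  have "vnorm ((A * B) *\<^sub>v v) = vnorm (A *\<^sub>v (B *\<^sub>v v))"
    using assoc_mult_mat_vec[OF assms v] by simp
  also have "\<dots> \<le> op_norm A * vnorm (B *\<^sub>v v)"
    using assms v by (intro vnorm_mult_mat_vec_le) auto
  also have "\<dots> \<le> op_norm A * (op_norm B * vnorm v)"
    using assms v by (intro mult_left_mono vnorm_mult_mat_vec_le op_norm_nonneg) auto
  finally show "vnorm ((A * B) *\<^sub>v v) \<le> op_norm A * op_norm B * vnorm v"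
    by (simp add: mult.assoc)
qed (simp add: op_norm_nonneg)

lemma op_norm_one: "op_norm (1\<^sub>m n) \<le> 1"
  by (rule op_norm_le) auto

text \<open>With \<open>w\<close> the image of \<open>v\<close> under the adjoint, the square of
  \<open>vnorm w\<close> is the inner product of \<open>A w\<close> with \<open>v\<close>, hence at
  most \<open>op_norm A * vnorm w * vnorm v\<close>; one factor \<open>vnorm w\<close>
  cancels.\<close>

lemma op_norm_adjoint:
  assumes A: "A \<in> carrier_mat n m"
  shows "op_norm (mat_adjoint A) \<le> op_norm A"
proof (rule op_norm_le)
  fix v :: "complex vec" assume "v \<in> carrier_vec (dim_col (mat_adjoint A))"
  then have v: "v \<in> carrier_vec n" using mat_adjoint_carrier[OF A] by simp
  define w where "w = mat_adjoint A *\<^sub>v v"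
  have w: "w \<in> carrier_vec m"
    using mat_adjoint_carrier[OF A] v by (simp add: w_def)
  have wi: "w $ i = (\<Sum>j<n. cnj (A $$ (j, i)) * v $ j)" if "i < m" for i
    unfolding w_def index_mult_mat_vec_sum[OF mat_adjoint_carrier[OF A] v that]
    using that A by (intro sum.cong) (auto simp: index_mat_adjoint)
  have "complex_of_real ((vnorm w)\<^sup>2) = (\<Sum>i<m. w $ i * cnj (w $ i))"
    using w by (simp add: vnorm_def L2_set_def sum_nonneg complex_norm_square[symmetric])
  also have "\<dots> = (\<Sum>i<m. \<Sum>j<n. w $ i * (A $$ (j, i) * cnj (v $ j)))"
    by (intro sum.cong refl) (subst (2) wi, auto simp: sum_distrib_left)
  also have "\<dots> = (\<Sum>j<n. \<Sum>i<m. w $ i * (A $$ (j, i) * cnj (v $ j)))"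
    by (rule sum.swap)
  \<comment> \<open>\<open>sum_mult_le_vnorm\<close> is bilinear, so the conjugation moves into the
    vector, whose norm it leaves unchanged.\<close>
  also have "\<dots> = (\<Sum>j<n. (A *\<^sub>v w) $ j * vec n (\<lambda>j. cnj (v $ j)) $ j)"
    by (intro sum.cong refl)
      (simp add: index_mult_mat_vec_sum[OF A w] sum_distrib_left sum_distrib_right mult.assoc
        mult.left_commute del: index_mult_mat_vec)
  finally have "(vnorm w)\<^sup>2 = cmod (\<Sum>j<n. (A *\<^sub>v w) $ j * vec n (\<lambda>j. cnj (v $ j)) $ j)"
    by (metis abs_power2 norm_of_real)
  also have "\<dots> \<le> vnorm (A *\<^sub>v w) * vnorm (vec n (\<lambda>j. cnj (v $ j)))"
    using A w by (intro sum_mult_le_vnorm) auto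
  also have "vnorm (vec n (\<lambda>j. cnj (v $ j))) = vnorm v"
    unfolding vnorm_def using v by (auto intro!: L2_set_cong)
  also have "vnorm (A *\<^sub>v w) * vnorm v \<le> (op_norm A * vnorm w) * vnorm v"
    using A w by (intro mult_right_mono vnorm_mult_mat_vec_le vnorm_nonneg) auto
  finally have "vnorm w * vnorm w \<le> (op_norm A * vnorm v) * vnorm w"
    by (simp add: power2_eq_square mult_ac)
  then have "vnorm w \<le> op_norm A * vnorm v \<or> vnorm w = 0"
    using vnorm_nonneg[of w] mult_right_le_imp_le[of "vnorm w" "vnorm w"] by force
  then show "vnorm (mat_adjoint A *\<^sub>v v) \<le> op_norm A * vnorm v"
    unfolding w_def using op_norm_nonneg[of A] vnorm_nonneg[of v] by auto
qed (simp add: op_norm_nonneg)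

lemma norm_entry_le_op_norm:
  assumes A: "A \<in> carrier_mat n m" and "i < n" "j < m"
  shows "cmod (A $$ (i, j)) \<le> op_norm A"
proof -
  have e: "vnorm (unit_vec m j) \<le> 1"
  proof -
    have "vnorm (unit_vec m j) \<le> (\<Sum>i<m. cmod (unit_vec m j $ i))"
      using vnorm_le_sum[of "unit_vec m j"] by simp
    also have "\<dots> = (\<Sum>i<m. if i = j then 1 else 0)"
      using \<open>j < m\<close> by (intro sum.cong) auto
    finally show ?thesis using \<open>j < m\<close> by simp
  qed
  have "cmod (A $$ (i, j)) = cmod ((A *\<^sub>v unit_vec m j) $ i)"
    using assms by simp
  also have "\<dots> \<le> vnorm (A *\<^sub>v unit_vec m j)"
    using assms by (intro component_le_vnorm) auto
  also have "\<dots> \<le> op_norm A * vnorm (unit_vec m j)"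
    using assms by (intro vnorm_mult_mat_vec_le) auto
  also have "\<dots> \<le> op_norm A * 1"
    by (intro mult_left_mono e op_norm_nonneg)
  finally show ?thesis by simp
qed

section \<open>The normalized trace\<close>

lemma norm_ntr_le_op_norm:
  assumes A: "A \<in> carrier_mat n n"
  shows "cmod (ntr A) \<le> op_norm A"
proof (cases "n = 0")
  case True
  then show ?thesis using A op_norm_nonneg by (simp add: ntr_def)
next
  case False
  have "cmod (\<Sum>i<n. A $$ (i, i)) \<le> of_nat (card {..<n}) * op_norm A"
    by (rule order_trans[OF norm_sum]) (intro sum_bounded_above norm_entry_le_op_norm[OF A], auto)
  then show ?thesis
    using A False by (simp add: ntr_def norm_divide divide_le_eq mult.commute)
qed

lemma ntr_add:
  assumes "A \<in> carrier_mat n n" "B \<in> carrier_mat n n"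
  shows "ntr (A + B) = ntr A + ntr B"
  using assms by (simp add: ntr_def sum.distrib add_divide_distrib)

lemma ntr_smult: "dim_row A = dim_col A \<Longrightarrow> ntr (c \<cdot>\<^sub>m A) = c * ntr A"
  by (simp add: ntr_def sum_distrib_left)

lemma ntr_one: "n > 0 \<Longrightarrow> ntr (1\<^sub>m n) = 1"
  by (simp add: ntr_def)

lemma ntr_mult_commute:
  assumes "A \<in> carrier_mat n m" "B \<in> carrier_mat m n" "n = m"
  shows "ntr (A * B) = ntr (B * A)"
proof -
  have "(\<Sum>i<n. (A * B) $$ (i, i)) = (\<Sum>i<n. \<Sum>l<m. A $$ (i, l) * B $$ (l, i))"
    using index_mult_mat_sum[OF assms(1,2)] by (intro sum.cong) auto
  also have "\<dots> = (\<Sum>l<m. \<Sum>i<n. A $$ (i, l) * B $$ (l, i))"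
    by (rule sum.swap)
  also have "\<dots> = (\<Sum>l<m. (B * A) $$ (l, l))"
    using index_mult_mat_sum[OF assms(2,1)] by (intro sum.cong) (auto simp: mult.commute)
  finally show ?thesis using assms by (simp add: ntr_def)
qed

text \<open>The right side is the normalized squared Hilbert-Schmidt norm. Being visibly real and
  nonnegative, it makes the Gibbs states positive.\<close>

lemma ntr_adjoint_mult:
  assumes A: "A \<in> carrier_mat n n"
  shows "ntr (mat_adjoint A * A) = of_real ((\<Sum>i<n. \<Sum>l<n. (cmod (A $$ (l, i)))\<^sup>2) / n)"
proof -
  have "(\<Sum>i<n. (mat_adjoint A * A) $$ (i, i)) = (\<Sum>i<n. \<Sum>l<n. cnj (A $$ (l, i)) * A $$ (l, i))"
    using index_mult_mat_sum[OF mat_adjoint_carrier[OF A] A] A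
    by (intro sum.cong refl) (auto simp: index_mat_adjoint intro!: sum.cong)
  also have "\<dots> = of_real (\<Sum>i<n. \<Sum>l<n. (cmod (A $$ (l, i)))\<^sup>2)"
    by (simp add: complex_norm_square[symmetric] mult.commute[of "cnj _"])
  finally show ?thesis
    using mat_adjoint_carrier[OF A] by (simp add: ntr_def)
qed

section \<open>The algebra of noncommutative functions\<close>

lemma mat_adjoint_mult:
  fixes A B :: "complex mat"
  assumes A: "A \<in> carrier_mat n m" and B: "B \<in> carrier_mat m k"
  shows "mat_adjoint (A * B) = mat_adjoint B * mat_adjoint A"
proof (rule eq_matI)
  note adj = mat_adjoint_carrier[OF A] mat_adjoint_carrier[OF B]
  show "dim_row (mat_adjoint (A * B)) = dim_row (mat_adjoint B * mat_adjoint A)"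
    "dim_col (mat_adjoint (A * B)) = dim_col (mat_adjoint B * mat_adjoint A)"
    using adj mat_adjoint_carrier[OF mult_carrier_mat[OF A B]] by auto
  fix i j assume "i < dim_row (mat_adjoint B * mat_adjoint A)" "j < dim_col (mat_adjoint B * mat_adjoint A)"
  then have ij: "i < k" "j < n" using adj by auto
  have "mat_adjoint (A * B) $$ (i, j) = (\<Sum>l<m. cnj (A $$ (j, l)) * cnj (B $$ (l, i)))"
    unfolding index_mat_adjoint[OF mult_carrier_mat[OF A B] ij] index_mult_mat_sum[OF A B ij(2,1)]
    by simp
  also have "\<dots> = (\<Sum>l<m. mat_adjoint B $$ (i, l) * mat_adjoint A $$ (l, j))"
    using ij by (intro sum.cong) (auto simp: index_mat_adjoint[OF A] index_mat_adjoint[OF B])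
  also have "\<dots> = (mat_adjoint B * mat_adjoint A) $$ (i, j)"
    by (rule index_mult_mat_sum[OF adj(2,1) ij, symmetric])
  finally show "mat_adjoint (A * B) $$ (i, j) = (mat_adjoint B * mat_adjoint A) $$ (i, j)" .
qed

lemma mat_adjoint_one: "mat_adjoint (1\<^sub>m n :: complex mat) = 1\<^sub>m n"
  using mat_adjoint_carrier[of "1\<^sub>m n" n n]
  by (intro eq_matI) (auto simp: index_mat_adjoint[of _ n n])

lemma mat_adjoint_diff:
  fixes A B :: "complex mat"
  assumes A: "A \<in> carrier_mat n m" and B: "B \<in> carrier_mat n m"
  shows "mat_adjoint (A - B) = mat_adjoint A - mat_adjoint B"
  using mat_adjoint_carrier[OF A] mat_adjoint_carrier[OF B]
    mat_adjoint_carrier[OF minus_carrier_mat[OF B], of A] A B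
  by (intro eq_matI) (auto simp: index_mat_adjoint[OF A] index_mat_adjoint[OF B]
      index_mat_adjoint[OF minus_carrier_mat[OF B]])

lemma eval_word_simps [simp]:
  "eval_word n A [] = 1\<^sub>m n"
  "eval_word n A (i # w) = A i * eval_word n A w"
  by (simp_all add: eval_word_def)

lemma eval_word_carrier:
  assumes "\<And>i. i \<in> set w \<Longrightarrow> A i \<in> carrier_mat n n"
  shows "eval_word n A w \<in> carrier_mat n n"
  using assms by (induction w) (auto intro!: mult_carrier_mat)

lemma eval_word_append:
  assumes "\<And>i. i \<in> set (u @ v) \<Longrightarrow> A i \<in> carrier_mat n n"
  shows "eval_word n A (u @ v) = eval_word n A u * eval_word n A v"
  using assms
proof (induction u)
  case Nil
  then show ?case using eval_word_carrier[of v A n] by simp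
next
  case (Cons i u)
  then have "A i \<in> carrier_mat n n" "eval_word n A u \<in> carrier_mat n n" "eval_word n A v \<in> carrier_mat n n"
    by (auto intro!: eval_word_carrier)
  then show ?case using Cons by (simp add: assoc_mult_mat[of _ n n _ n _ n])
qed

text \<open>Adjoints reverse products and the letters are selfadjoint, so reversal is the right
  involution on words.\<close>

lemma eval_word_rev:
  assumes "\<And>i. i \<in> set w \<Longrightarrow> A i \<in> carrier_mat n n \<and> mat_adjoint (A i) = A i"
  shows "eval_word n A (rev w) = mat_adjoint (eval_word n A w)"
  using assms
proof (induction w)
  case Nil
  then show ?case by (simp add: mat_adjoint_one)
next
  case (Cons i w)
  then have c: "A i \<in> carrier_mat n n" "eval_word n A w \<in> carrier_mat n n"
    by (auto intro!: eval_word_carrier)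
  have "eval_word n A (rev (i # w)) = eval_word n A (rev w) * (A i * 1\<^sub>m n)"
    using Cons.prems by (subst rev.simps, subst eval_word_append) auto
  then show ?case using Cons c by (simp add: mat_adjoint_mult[of _ n n _ n])
qed

lemma op_norm_eval_word:
  assumes "\<And>i. i \<in> set w \<Longrightarrow> A i \<in> carrier_mat n n \<and> op_norm (A i) \<le> R" and "0 \<le> R"
  shows "op_norm (eval_word n A w) \<le> R ^ length w"
  using assms(1)
proof (induction w)
  case Nil
  then show ?case by (simp add: op_norm_one)
next
  case (Cons i w)
  have "op_norm (eval_word n A (i # w)) \<le> op_norm (A i) * op_norm (eval_word n A w)"
    using Cons.prems by (auto intro!: op_norm_mult[of _ n n _ n] eval_word_carrier)
  also have "\<dots> \<le> R * R ^ length w"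
    using Cons \<open>0 \<le> R\<close> by (intro mult_mono) (auto simp: op_norm_nonneg)
  finally show ?case by simp
qed

section \<open>Polynomials and their evaluation\<close>

lemma eval_poly_carrier [simp]: "eval_poly n A p \<in> carrier_mat n n"
  by (simp add: eval_poly_def)

lemma diff_eval_poly_carrier [simp]: "B - eval_poly n A p \<in> carrier_mat n n"
  by (rule minus_carrier_mat) simp

lemma eval_poly_dims [simp]: "dim_row (eval_poly n A p) = n" "dim_col (eval_poly n A p) = n"
  by (simp_all add: eval_poly_def)

text \<open>Summing over any finite set that contains the support lets two polynomials be expanded
  over one common index set.\<close>

lemma eval_poly_index:
  assumes "i < n" "j < n" "finite S" "Poly_Mapping.keys p \<subseteq> S"
  shows "eval_poly n A p $$ (i, j) = (\<Sum>w\<in>S. Poly_Mapping.lookup p w * eval_word n A w $$ (i, j))"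
  using assms unfolding eval_poly_def
  by (auto simp: in_keys_iff intro!: sum.mono_neutral_left)

lemma eval_poly_add: "eval_poly n A (p + q) = eval_poly n A p + eval_poly n A q"
proof (rule eq_matI)
  fix i j assume "i < dim_row (eval_poly n A p + eval_poly n A q)" "j < dim_col (eval_poly n A p + eval_poly n A q)"
  then have ij: "i < n" "j < n" by auto
  let ?S = "Poly_Mapping.keys p \<union> Poly_Mapping.keys q"
  show "eval_poly n A (p + q) $$ (i, j) = (eval_poly n A p + eval_poly n A q) $$ (i, j)"
    using ij Poly_Mapping.keys_add[of p q]
    by (simp add: eval_poly_index[where S = ?S] lookup_add distrib_right sum.distrib)
qed auto

lemma eval_poly_sum_index:
  assumes "i < n" "j < n"
  shows "eval_poly n A (\<Sum>s\<in>S. f s) $$ (i, j) = (\<Sum>s\<in>S. eval_poly n A (f s) $$ (i, j))"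
proof (induction S rule: infinite_finite_induct)
  case (insert s S)
  then show ?case using assms by (simp add: eval_poly_add)
qed (use assms in \<open>simp_all add: eval_poly_def\<close>)

lemma eval_poly_single:
  assumes "i < n" "j < n"
  shows "eval_poly n A (Poly_Mapping.single w c) $$ (i, j) = c * eval_word n A w $$ (i, j)"
  using assms by (subst eval_poly_index[where S = "{w}"]) auto

lemma ncpolys_single: "w \<in> lists {..<N} \<Longrightarrow> Poly_Mapping.single w c \<in> ncpolys N"
  by (auto simp: ncpolys_def)

lemma ncpolys_add: "p \<in> ncpolys N \<Longrightarrow> q \<in> ncpolys N \<Longrightarrow> p + q \<in> ncpolys N"
  using Poly_Mapping.keys_add[of p q] by (auto simp: ncpolys_def)

lemma ncpolys_sum: "(\<And>s. s \<in> S \<Longrightarrow> f s \<in> ncpolys N) \<Longrightarrow> (\<Sum>s\<in>S. f s) \<in> ncpolys N"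
proof (induction S rule: infinite_finite_induct)
  case (insert s S)
  then show ?case by (simp add: ncpolys_add)
qed (simp_all add: ncpolys_def)

text \<open>This operation and the next two are sums of monomials rather than coefficient formulas,
  so that evaluation and membership in \<open>ncpolys\<close> reduce to single words. In the
  product, different pairs of words with the same concatenation are then added up correctly.\<close>

definition poly_scale :: "complex \<Rightarrow> ncpoly \<Rightarrow> ncpoly" where
  "poly_scale c p = (\<Sum>w\<in>Poly_Mapping.keys p. Poly_Mapping.single w (c * Poly_Mapping.lookup p w))"

definition poly_mult :: "ncpoly \<Rightarrow> ncpoly \<Rightarrow> ncpoly" where
  "poly_mult p q = (\<Sum>(u, v)\<in>Poly_Mapping.keys p \<times> Poly_Mapping.keys q.
     Poly_Mapping.single (u @ v) (Poly_Mapping.lookup p u * Poly_Mapping.lookup q v))"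

definition poly_star :: "ncpoly \<Rightarrow> ncpoly" where
  "poly_star p = (\<Sum>w\<in>Poly_Mapping.keys p. Poly_Mapping.single (rev w) (cnj (Poly_Mapping.lookup p w)))"

lemma ncpolys_keysD: "p \<in> ncpolys N \<Longrightarrow> w \<in> Poly_Mapping.keys p \<Longrightarrow> w \<in> lists {..<N}"
  by (auto simp: ncpolys_def)

lemma poly_scale_ncpolys: "p \<in> ncpolys N \<Longrightarrow> poly_scale c p \<in> ncpolys N"
  unfolding poly_scale_def by (intro ncpolys_sum ncpolys_single ncpolys_keysD)

lemma poly_mult_ncpolys:
  assumes p: "p \<in> ncpolys N" and q: "q \<in> ncpolys N"
  shows "poly_mult p q \<in> ncpolys N"
  unfolding poly_mult_def
proof (rule ncpolys_sum)
  fix s assume "s \<in> Poly_Mapping.keys p \<times> Poly_Mapping.keys q"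
  then have "fst s @ snd s \<in> lists {..<N}"
    using ncpolys_keysD[OF p, of "fst s"] ncpolys_keysD[OF q, of "snd s"] by auto
  then show "(case s of (u, v) \<Rightarrow> Poly_Mapping.single (u @ v)
      (Poly_Mapping.lookup p u * Poly_Mapping.lookup q v)) \<in> ncpolys N"
    by (simp add: ncpolys_single case_prod_unfold)
qed

lemma poly_star_ncpolys: "p \<in> ncpolys N \<Longrightarrow> poly_star p \<in> ncpolys N"
  unfolding poly_star_def by (intro ncpolys_sum ncpolys_single) (auto simp: ncpolys_def)

lemma lookup_poly_scale: "Poly_Mapping.lookup (poly_scale c p) w = c * Poly_Mapping.lookup p w"
  by (auto simp: poly_scale_def lookup_sum lookup_single when_def sum.delta' in_keys_iff)

lemma lookup_poly_star: "Poly_Mapping.lookup (poly_star p) w = cnj (Poly_Mapping.lookup p (rev w))"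
proof -
  have eq: "rev u = w \<longleftrightarrow> u = rev w" for u by auto
  show ?thesis
    by (auto simp: poly_star_def lookup_sum lookup_single when_def eq sum.delta' in_keys_iff)
qed

lemma eval_poly_scale: "eval_poly n A (poly_scale c p) = c \<cdot>\<^sub>m eval_poly n A p"
  by (rule eq_matI)
    (auto simp: poly_scale_def eval_poly_sum_index eval_poly_single sum_distrib_left mult.assoc
      eval_poly_index[where S = "Poly_Mapping.keys p" and p = p])

lemma eval_poly_mult:
  assumes p: "p \<in> ncpolys N" and q: "q \<in> ncpolys N" and A: "\<And>i. i < N \<Longrightarrow> A i \<in> carrier_mat n n"
  shows "eval_poly n A (poly_mult p q) = eval_poly n A p * eval_poly n A q"
proof (rule eq_matI)
  fix i j assume "i < dim_row (eval_poly n A p * eval_poly n A q)" "j < dim_col (eval_poly n A p * eval_poly n A q)"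
  then have ij: "i < n" "j < n" by auto
  let ?P = "Poly_Mapping.keys p" and ?Q = "Poly_Mapping.keys q"
  let ?p = "Poly_Mapping.lookup p" and ?q = "Poly_Mapping.lookup q"
  let ?e = "eval_word n A"
  have uv: "?e (u @ v) $$ (i, j) = (\<Sum>l<n. ?e u $$ (i, l) * ?e v $$ (l, j))"
    if "u \<in> ?P" "v \<in> ?Q" for u v
  proof -
    have "\<And>i. i \<in> set (u @ v) \<Longrightarrow> A i \<in> carrier_mat n n"
      using ncpolys_keysD[OF p that(1)] ncpolys_keysD[OF q that(2)] A by auto
    then show ?thesis
      using ij by (subst eval_word_append) (auto intro!: index_mult_mat_sum[of _ n n _ n] eval_word_carrier)
  qed
  have "eval_poly n A (poly_mult p q) $$ (i, j)
    = (\<Sum>u\<in>?P. \<Sum>v\<in>?Q. ?p u * ?q v * ?e (u @ v) $$ (i, j))"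
    using ij by (simp add: poly_mult_def eval_poly_sum_index eval_poly_single case_prod_unfold
        sum.cartesian_product)
  also have "\<dots> = (\<Sum>u\<in>?P. \<Sum>v\<in>?Q. \<Sum>l<n. (?p u * ?e u $$ (i, l)) * (?q v * ?e v $$ (l, j)))"
    by (intro sum.cong refl) (simp add: uv sum_distrib_left mult_ac)
  also have "\<dots> = (\<Sum>u\<in>?P. \<Sum>l<n. \<Sum>v\<in>?Q. (?p u * ?e u $$ (i, l)) * (?q v * ?e v $$ (l, j)))"
    by (intro sum.cong refl sum.swap)
  also have "\<dots> = (\<Sum>l<n. \<Sum>u\<in>?P. \<Sum>v\<in>?Q. (?p u * ?e u $$ (i, l)) * (?q v * ?e v $$ (l, j)))"
    by (rule sum.swap)
  also have "\<dots> = (\<Sum>l<n. eval_poly n A p $$ (i, l) * eval_poly n A q $$ (l, j))"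
    using ij by (intro sum.cong refl)
      (simp add: eval_poly_index[where S = ?P and p = p] eval_poly_index[where S = ?Q and p = q] sum_product)
  also have "\<dots> = (eval_poly n A p * eval_poly n A q) $$ (i, j)"
    using ij by (intro index_mult_mat_sum[of _ n n _ n, symmetric]) auto
  finally show "eval_poly n A (poly_mult p q) $$ (i, j) = (eval_poly n A p * eval_poly n A q) $$ (i, j)" .
qed auto

lemma eval_poly_star:
  assumes p: "p \<in> ncpolys N"
    and A: "\<And>i. i < N \<Longrightarrow> A i \<in> carrier_mat n n \<and> mat_adjoint (A i) = A i"
  shows "eval_poly n A (poly_star p) = mat_adjoint (eval_poly n A p)"
proof (rule eq_matI)
  have c: "mat_adjoint (eval_poly n A p) \<in> carrier_mat n n"
    by (rule mat_adjoint_carrier) simp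
  then show "dim_row (eval_poly n A (poly_star p)) = dim_row (mat_adjoint (eval_poly n A p))"
    "dim_col (eval_poly n A (poly_star p)) = dim_col (mat_adjoint (eval_poly n A p))" by auto
  fix i j assume "i < dim_row (mat_adjoint (eval_poly n A p))" "j < dim_col (mat_adjoint (eval_poly n A p))"
  then have ij: "i < n" "j < n" using c by auto
  have w: "eval_word n A (rev w) $$ (i, j) = cnj (eval_word n A w $$ (j, i))"
    if "w \<in> Poly_Mapping.keys p" for w
  proof -
    have "\<And>i. i \<in> set w \<Longrightarrow> A i \<in> carrier_mat n n \<and> mat_adjoint (A i) = A i"
      using ncpolys_keysD[OF p that] A by auto
    then show ?thesis
      using ij eval_word_carrier[of w A n] by (simp add: eval_word_rev index_mat_adjoint[of _ n n])
  qed
  show "eval_poly n A (poly_star p) $$ (i, j) = mat_adjoint (eval_poly n A p) $$ (i, j)"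
    using ij by (simp add: poly_star_def eval_poly_sum_index eval_poly_single w
        index_mat_adjoint[of _ n n] eval_poly_index[where S = "Poly_Mapping.keys p" and p = p])
qed

section \<open>Uniform bounds and polynomial approximation\<close>

lemma sa_ballsD:
  assumes "A \<in> sa_balls N R n" "i < N"
  shows "A i \<in> carrier_mat n n" "mat_adjoint (A i) = A i" "op_norm (A i) \<le> R"
  using assms by (auto simp: sa_balls_def sa_mats_def PiE_iff)

lemma eval_dom_iff: "(n, A) \<in> eval_dom N R \<longleftrightarrow> n \<ge> 1 \<and> A \<in> sa_balls N R n"
  by (auto simp: eval_dom_def)

text \<open>Independence of \<open>n\<close> and of the tuple is the point: it makes the supremum
  norm of a polynomial finite over all dimensions at once.\<close>

lemma op_norm_eval_poly:
  assumes p: "p \<in> ncpolys N" and A: "A \<in> sa_balls N R n" and "0 \<le> R"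
  shows "op_norm (eval_poly n A p)
    \<le> (\<Sum>w\<in>Poly_Mapping.keys p. cmod (Poly_Mapping.lookup p w) * R ^ length w)"
proof -
  let ?c = "Poly_Mapping.lookup p"
  \<comment> \<open>Partial sums over a set of words with the coefficients of \<open>p\<close> kept
    fixed, so that the induction adds one word at a time.\<close>
  define E where "E S = Matrix.mat n n (\<lambda>ij. \<Sum>w\<in>S. ?c w * eval_word n A w $$ ij)" for S
  have "op_norm (E S) \<le> (\<Sum>w\<in>S. cmod (?c w) * R ^ length w)"
    if "finite S" "S \<subseteq> Poly_Mapping.keys p" for S
    using that
  proof (induction S rule: finite_induct)
    case empty
    then show ?case using op_norm_le_sum[of "E {}" n n] by (simp add: E_def)
  next
    case (insert w S)
    have w: "\<And>i. i \<in> set w \<Longrightarrow> A i \<in> carrier_mat n n \<and> op_norm (A i) \<le> R"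
      using ncpolys_keysD[OF p, of w] insert sa_ballsD[OF A] by auto
    then have c: "eval_word n A w \<in> carrier_mat n n" by (intro eval_word_carrier) auto
    have "E (insert w S) = ?c w \<cdot>\<^sub>m eval_word n A w + E S"
      using c insert by (intro eq_matI) (auto simp: E_def)
    then have "op_norm (E (insert w S)) \<le> op_norm (?c w \<cdot>\<^sub>m eval_word n A w) + op_norm (E S)"
      using c op_norm_add[of "?c w \<cdot>\<^sub>m eval_word n A w" n n "E S"] by (simp add: E_def)
    also have "op_norm (?c w \<cdot>\<^sub>m eval_word n A w) \<le> cmod (?c w) * op_norm (eval_word n A w)"
      by (rule op_norm_smult)
    also have "\<dots> \<le> cmod (?c w) * R ^ length w"
      using w \<open>0 \<le> R\<close> by (intro mult_left_mono op_norm_eval_word) auto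
    finally show ?case using insert by auto
  qed
  from this[of "Poly_Mapping.keys p"] show ?thesis by (simp add: E_def eval_poly_def)
qed

text \<open>Turns the \<open>ereal\<close> supremum into a bound at each point. The definition asks
  for a strict inequality, while pointwise bounds survive a supremum only non-strictly; halving
  \<epsilon> absorbs the difference.\<close>

lemma nc_alg_iff:
  "h \<in> nc_alg N R \<longleftrightarrow> h \<in> extensional (eval_dom N R) \<and>
     (\<forall>n A. (n, A) \<in> eval_dom N R \<longrightarrow> h (n, A) \<in> carrier_mat n n) \<and>
     (\<forall>\<epsilon>>0. \<exists>p\<in>ncpolys N. \<forall>n A. (n, A) \<in> eval_dom N R \<longrightarrow> op_norm (h (n, A) - eval_poly n A p) \<le> \<epsilon>)"
proof -
  have diff: "nc_norm N R (nc_diff N R h (of_poly N R p))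
      = (SUP (n, A)\<in>eval_dom N R. ereal (op_norm (h (n, A) - eval_poly n A p)))" for p
    by (auto simp: nc_norm_def nc_diff_def of_poly_def intro!: SUP_cong)
  have 1: "\<exists>p\<in>ncpolys N. nc_norm N R (nc_diff N R h (of_poly N R p)) < ereal \<epsilon>"
    if *: "\<forall>\<epsilon>>0. \<exists>p\<in>ncpolys N. \<forall>n A. (n, A) \<in> eval_dom N R \<longrightarrow> op_norm (h (n, A) - eval_poly n A p) \<le> \<epsilon>"
      and "\<epsilon> > 0" for \<epsilon>
  proof -
    from *[rule_format, of "\<epsilon> / 2"] \<open>\<epsilon> > 0\<close> obtain p where p: "p \<in> ncpolys N"
      "\<And>n A. (n, A) \<in> eval_dom N R \<Longrightarrow> op_norm (h (n, A) - eval_poly n A p) \<le> \<epsilon> / 2" by auto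
    have "nc_norm N R (nc_diff N R h (of_poly N R p)) \<le> ereal (\<epsilon> / 2)"
      unfolding diff using p by (intro SUP_least) auto
    also have "\<dots> < ereal \<epsilon>" using \<open>\<epsilon> > 0\<close> by simp
    finally show ?thesis using p by blast
  qed
  have 2: "\<exists>p\<in>ncpolys N. \<forall>n A. (n, A) \<in> eval_dom N R \<longrightarrow> op_norm (h (n, A) - eval_poly n A p) \<le> \<epsilon>"
    if *: "\<forall>\<epsilon>>0. \<exists>p\<in>ncpolys N. nc_norm N R (nc_diff N R h (of_poly N R p)) < ereal \<epsilon>"
      and "\<epsilon> > 0" for \<epsilon>
  proof -
    from * \<open>\<epsilon> > 0\<close> obtain p where p: "p \<in> ncpolys N"
      "nc_norm N R (nc_diff N R h (of_poly N R p)) < ereal \<epsilon>" by auto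
    have "op_norm (h (n, A) - eval_poly n A p) \<le> \<epsilon>" if "(n, A) \<in> eval_dom N R" for n A
    proof -
      have "ereal (op_norm (h (n, A) - eval_poly n A p)) \<le> nc_norm N R (nc_diff N R h (of_poly N R p))"
        unfolding diff using that by (intro SUP_upper2[of "(n, A)"]) auto
      also note p(2)
      finally show ?thesis by simp
    qed
    then show ?thesis using p by blast
  qed
  show ?thesis
    unfolding nc_alg_def using 1 2 by (auto simp: PiE_iff)
qed

lemma nc_alg_carrier: "h \<in> nc_alg N R \<Longrightarrow> (n, A) \<in> eval_dom N R \<Longrightarrow> h (n, A) \<in> carrier_mat n n"
  by (simp add: nc_alg_iff)

lemma nc_alg_approx:
  assumes "h \<in> nc_alg N R" "\<epsilon> > 0"
  obtains p where "p \<in> ncpolys N"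
    "\<And>n A. (n, A) \<in> eval_dom N R \<Longrightarrow> op_norm (h (n, A) - eval_poly n A p) \<le> \<epsilon>"
  using assms by (auto simp: nc_alg_iff)

lemma op_norm_zero: "op_norm (0\<^sub>m n m) = 0"
  using op_norm_le_sum[of "0\<^sub>m n m" n m] op_norm_nonneg[of "0\<^sub>m n m"] by simp

lemma of_poly_nc_alg:
  assumes "p \<in> ncpolys N"
  shows "of_poly N R p \<in> nc_alg N R"
proof -
  have "\<forall>n A. (n, A) \<in> eval_dom N R \<longrightarrow> op_norm (of_poly N R p (n, A) - eval_poly n A p) = 0"
    by (auto simp: of_poly_def op_norm_zero minus_r_inv_mat[OF eval_poly_carrier])
  then show ?thesis
    unfolding nc_alg_iff using assms by (auto simp: of_poly_def intro!: bexI[of _ p])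
qed

text \<open>A polynomial within distance 1 of \<open>h\<close> hands over its dimension-free
  bound.\<close>

lemma nc_alg_bounded:
  assumes h: "h \<in> nc_alg N R" and "0 \<le> R"
  obtains C where "0 \<le> C" "\<And>n A. (n, A) \<in> eval_dom N R \<Longrightarrow> op_norm (h (n, A)) \<le> C"
proof -
  obtain p where p: "p \<in> ncpolys N"
    "\<And>n A. (n, A) \<in> eval_dom N R \<Longrightarrow> op_norm (h (n, A) - eval_poly n A p) \<le> 1"
    using nc_alg_approx[OF h, of 1] by auto
  let ?D = "\<Sum>w\<in>Poly_Mapping.keys p. cmod (Poly_Mapping.lookup p w) * R ^ length w"
  have "op_norm (h (n, A)) \<le> 1 + ?D" if dom: "(n, A) \<in> eval_dom N R" for n A
  proof -
    have c: "h (n, A) \<in> carrier_mat n n" using nc_alg_carrier[OF h dom] .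
    then have "h (n, A) = (h (n, A) - eval_poly n A p) + eval_poly n A p"
      by (intro eq_matI) auto
    then have "op_norm (h (n, A)) \<le> op_norm (h (n, A) - eval_poly n A p) + op_norm (eval_poly n A p)"
      using op_norm_add[of "h (n, A) - eval_poly n A p" n n "eval_poly n A p"] c by simp
    also have "\<dots> \<le> 1 + ?D"
      using dom p \<open>0 \<le> R\<close> by (intro add_mono op_norm_eval_poly) (auto simp: eval_dom_iff)
    finally show ?thesis .
  qed
  moreover have "0 \<le> 1 + ?D" using \<open>0 \<le> R\<close> by (simp add: add_nonneg_nonneg sum_nonneg)
  ultimately show ?thesis using that by blast
qed

section \<open>Closure of the algebra under its operations\<close>

lemma nc_one_nc_alg: "nc_one N R \<in> nc_alg N R"
proof -
  have "eval_poly n A (Poly_Mapping.single [] 1) = 1\<^sub>m n" for n A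
    by (rule eq_matI) (auto simp: eval_poly_single)
  then have "nc_one N R = of_poly N R (Poly_Mapping.single [] 1)"
    by (simp add: nc_one_def of_poly_def)
  then show ?thesis by (simp add: of_poly_nc_alg ncpolys_single)
qed

lemma nc_add_nc_alg:
  assumes a: "a \<in> nc_alg N R" and b: "b \<in> nc_alg N R"
  shows "nc_add N R a b \<in> nc_alg N R"
proof -
  have "\<exists>r\<in>ncpolys N. \<forall>n A. (n, A) \<in> eval_dom N R \<longrightarrow> op_norm (nc_add N R a b (n, A) - eval_poly n A r) \<le> \<epsilon>"
    if "\<epsilon> > 0" for \<epsilon>
  proof -
    from \<open>\<epsilon> > 0\<close> have "\<epsilon> / 2 > 0" by simp
    obtain p where p: "p \<in> ncpolys N"
      "\<And>n A. (n, A) \<in> eval_dom N R \<Longrightarrow> op_norm (a (n, A) - eval_poly n A p) \<le> \<epsilon> / 2"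
      using nc_alg_approx[OF a \<open>\<epsilon> / 2 > 0\<close>] by auto
    obtain q where q: "q \<in> ncpolys N"
      "\<And>n A. (n, A) \<in> eval_dom N R \<Longrightarrow> op_norm (b (n, A) - eval_poly n A q) \<le> \<epsilon> / 2"
      using nc_alg_approx[OF b \<open>\<epsilon> / 2 > 0\<close>] by auto
    have "op_norm (nc_add N R a b (n, A) - eval_poly n A (p + q)) \<le> \<epsilon>" if dom: "(n, A) \<in> eval_dom N R" for n A
    proof -
      note c = nc_alg_carrier[OF a dom] nc_alg_carrier[OF b dom]
      have "nc_add N R a b (n, A) - eval_poly n A (p + q)
        = (a (n, A) - eval_poly n A p) + (b (n, A) - eval_poly n A q)"
        using c dom by (intro eq_matI) (auto simp: nc_add_def eval_poly_add)
      also have "op_norm \<dots> \<le> op_norm (a (n, A) - eval_poly n A p) + op_norm (b (n, A) - eval_poly n A q)"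
        using c by (intro op_norm_add[of _ n n]) auto
      also have "\<dots> \<le> \<epsilon>" using p(2)[OF dom] q(2)[OF dom] by simp
      finally show ?thesis .
    qed
    then show ?thesis using p q by (auto intro!: bexI[of _ "p + q"] ncpolys_add)
  qed
  then show ?thesis
    using nc_alg_carrier[OF a] nc_alg_carrier[OF b] unfolding nc_alg_iff by (auto simp: nc_add_def)
qed

lemma nc_scale_nc_alg:
  assumes a: "a \<in> nc_alg N R"
  shows "nc_scale N R c a \<in> nc_alg N R"
proof -
  have "\<exists>r\<in>ncpolys N. \<forall>n A. (n, A) \<in> eval_dom N R \<longrightarrow> op_norm (nc_scale N R c a (n, A) - eval_poly n A r) \<le> \<epsilon>"
    if "\<epsilon> > 0" for \<epsilon>
  proof -
    \<comment> \<open>Adding 1 keeps the divisor positive when \<open>c\<close> vanishes.\<close>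
    have cpos: "cmod c + 1 > 0" by (smt (verit) norm_ge_zero)
    then have "\<epsilon> / (cmod c + 1) > 0" using \<open>\<epsilon> > 0\<close> by simp
    then obtain p where p: "p \<in> ncpolys N"
      "\<And>n A. (n, A) \<in> eval_dom N R \<Longrightarrow> op_norm (a (n, A) - eval_poly n A p) \<le> \<epsilon> / (cmod c + 1)"
      using nc_alg_approx[OF a] by metis
    have "op_norm (nc_scale N R c a (n, A) - eval_poly n A (poly_scale c p)) \<le> \<epsilon>"
      if dom: "(n, A) \<in> eval_dom N R" for n A
    proof -
      have "nc_scale N R c a (n, A) - eval_poly n A (poly_scale c p) = c \<cdot>\<^sub>m (a (n, A) - eval_poly n A p)"
        using nc_alg_carrier[OF a dom] dom
        by (intro eq_matI) (auto simp: nc_scale_def eval_poly_scale algebra_simps)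
      also have "op_norm \<dots> \<le> cmod c * op_norm (a (n, A) - eval_poly n A p)"
        by (rule op_norm_smult)
      also have "\<dots> \<le> (cmod c + 1) * (\<epsilon> / (cmod c + 1))"
        using p(2)[OF dom] cpos by (intro mult_mono op_norm_nonneg) auto
      finally show ?thesis using cpos by simp
    qed
    then show ?thesis using p by (auto intro!: bexI[of _ "poly_scale c p"] poly_scale_ncpolys)
  qed
  then show ?thesis
    using nc_alg_carrier[OF a] unfolding nc_alg_iff by (auto simp: nc_scale_def)
qed

text \<open>Uses \<open>a b - p q = a (b - q) + (a - p) q\<close>. The first summand needs a bound
  on \<open>a\<close>, the second a bound on \<open>q\<close>; so \<open>q\<close> is chosen before
  the accuracy of \<open>p\<close> is fixed.\<close>

lemma nc_mult_nc_alg: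
  assumes a: "a \<in> nc_alg N R" and b: "b \<in> nc_alg N R" and "0 \<le> R"
  shows "nc_mult N R a b \<in> nc_alg N R"
proof -
  obtain C where C: "0 \<le> C" "\<And>n A. (n, A) \<in> eval_dom N R \<Longrightarrow> op_norm (a (n, A)) \<le> C"
    using nc_alg_bounded[OF a \<open>0 \<le> R\<close>] by metis
  have "\<exists>r\<in>ncpolys N. \<forall>n A. (n, A) \<in> eval_dom N R \<longrightarrow> op_norm (nc_mult N R a b (n, A) - eval_poly n A r) \<le> \<epsilon>"
    if "\<epsilon> > 0" for \<epsilon>
  proof -
    have "\<epsilon> / (2 * (C + 1)) > 0" using \<open>\<epsilon> > 0\<close> C(1) by simp
    then obtain q where q: "q \<in> ncpolys N"
      "\<And>n A. (n, A) \<in> eval_dom N R \<Longrightarrow> op_norm (b (n, A) - eval_poly n A q) \<le> \<epsilon> / (2 * (C + 1))"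
      using nc_alg_approx[OF b] by metis
    obtain D where D: "0 \<le> D" "\<And>n A. (n, A) \<in> eval_dom N R \<Longrightarrow> op_norm (of_poly N R q (n, A)) \<le> D"
      using nc_alg_bounded[OF of_poly_nc_alg[OF q(1)] \<open>0 \<le> R\<close>] by metis
    have "\<epsilon> / (2 * (D + 1)) > 0" using \<open>\<epsilon> > 0\<close> D(1) by simp
    then obtain p where p: "p \<in> ncpolys N"
      "\<And>n A. (n, A) \<in> eval_dom N R \<Longrightarrow> op_norm (a (n, A) - eval_poly n A p) \<le> \<epsilon> / (2 * (D + 1))"
      using nc_alg_approx[OF a] by metis
    have "op_norm (nc_mult N R a b (n, A) - eval_poly n A (poly_mult p q)) \<le> \<epsilon>"
      if dom: "(n, A) \<in> eval_dom N R" for n A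
    proof -
      let ?a = "a (n, A)" and ?b = "b (n, A)" and ?p = "eval_poly n A p" and ?q = "eval_poly n A q"
      note c = nc_alg_carrier[OF a dom] nc_alg_carrier[OF b dom]
      have "eval_poly n A (poly_mult p q) = ?p * ?q"
        using dom sa_ballsD by (intro eval_poly_mult[OF p(1) q(1)]) (auto simp: eval_dom_iff)
      moreover have "?a * (?b - ?q) = ?a * ?b - ?a * ?q" "(?a - ?p) * ?q = ?a * ?q - ?p * ?q"
        using c by (auto intro!: mult_minus_distrib_mat[of _ n n _ n] minus_mult_distrib_mat[of _ n n _ _ n])
      ultimately have "nc_mult N R a b (n, A) - eval_poly n A (poly_mult p q)
          = ?a * (?b - ?q) + (?a - ?p) * ?q"
        using c dom by (intro eq_matI) (auto simp: nc_mult_def)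
      also have "op_norm \<dots> \<le> op_norm (?a * (?b - ?q)) + op_norm ((?a - ?p) * ?q)"
        using c by (intro op_norm_add[of _ n n]) (auto intro!: mult_carrier_mat)
      also have "\<dots> \<le> op_norm ?a * op_norm (?b - ?q) + op_norm (?a - ?p) * op_norm ?q"
        using c by (intro add_mono op_norm_mult[of _ n n _ n]) auto
      also have "\<dots> \<le> (C + 1) * (\<epsilon> / (2 * (C + 1))) + \<epsilon> / (2 * (D + 1)) * (D + 1)"
        using C(1) C(2)[OF dom] D(1) D(2)[OF dom] p(2)[OF dom] q(2)[OF dom] dom \<open>\<epsilon> > 0\<close>
        by (intro add_mono mult_mono op_norm_nonneg) (auto simp: of_poly_def)
      also have "\<dots> = \<epsilon> / 2 + \<epsilon> / 2" using C(1) D(1) by (intro arg_cong2[of _ _ _ _ "(+)"]) (auto simp: divide_simps)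
      also have "\<dots> = \<epsilon>" by simp
      finally show ?thesis .
    qed
    then show ?thesis using p q by (auto intro!: bexI[of _ "poly_mult p q"] poly_mult_ncpolys)
  qed
  then show ?thesis
    using nc_alg_carrier[OF a] nc_alg_carrier[OF b] unfolding nc_alg_iff
    by (auto simp: nc_mult_def intro!: mult_carrier_mat)
qed

text \<open>The adjoint does not increase the norm, so \<open>poly_star p\<close> approximates the
  adjoint as well as \<open>p\<close> approximates \<open>h\<close>. Closure under
  \<open>nc_star\<close> and the symmetrization of approximants both rest on this.\<close>

lemma op_norm_adjoint_diff_poly_star:
  assumes c: "h \<in> carrier_mat n n" and p: "p \<in> ncpolys N" and A: "A \<in> sa_balls N R n"
  shows "op_norm (mat_adjoint h - eval_poly n A (poly_star p)) \<le> op_norm (h - eval_poly n A p)"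
proof -
  have "mat_adjoint h - eval_poly n A (poly_star p) = mat_adjoint (h - eval_poly n A p)"
    using sa_ballsD[OF A] c
    by (simp add: eval_poly_star[OF p] mat_adjoint_diff[of _ n n])
  then show ?thesis using op_norm_adjoint[of "h - eval_poly n A p" n n] c by simp
qed

lemma nc_star_nc_alg:
  assumes a: "a \<in> nc_alg N R"
  shows "nc_star N R a \<in> nc_alg N R"
proof -
  have "\<exists>r\<in>ncpolys N. \<forall>n A. (n, A) \<in> eval_dom N R \<longrightarrow> op_norm (nc_star N R a (n, A) - eval_poly n A r) \<le> \<epsilon>"
    if "\<epsilon> > 0" for \<epsilon>
  proof -
    obtain p where p: "p \<in> ncpolys N"
      "\<And>n A. (n, A) \<in> eval_dom N R \<Longrightarrow> op_norm (a (n, A) - eval_poly n A p) \<le> \<epsilon>"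
      using nc_alg_approx[OF a \<open>\<epsilon> > 0\<close>] by metis
    have "op_norm (nc_star N R a (n, A) - eval_poly n A (poly_star p)) \<le> \<epsilon>"
      if dom: "(n, A) \<in> eval_dom N R" for n A
      using order_trans[OF op_norm_adjoint_diff_poly_star[OF nc_alg_carrier[OF a dom] p(1), of A R] p(2)[OF dom]]
        dom by (simp add: nc_star_def eval_dom_iff)
    then show ?thesis using p by (auto intro!: bexI[of _ "poly_star p"] poly_star_ncpolys)
  qed
  then show ?thesis
    using nc_alg_carrier[OF a] unfolding nc_alg_iff by (auto simp: nc_star_def intro!: mat_adjoint_carrier)
qed

text \<open>Needed because the infimum in \<open>eta\<close> admits selfadjoint polynomials only.
  Averaging \<open>p\<close> with \<open>poly_star p\<close> costs no accuracy, since
  \<open>h\<close> is its own adjoint.\<close>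

lemma nc_alg_sa_approx:
  assumes h: "h \<in> nc_alg_sa N R" and "\<epsilon> > 0"
  obtains p where "p \<in> ncpolys_sa N"
    "\<And>n A. (n, A) \<in> eval_dom N R \<Longrightarrow> op_norm (h (n, A) - eval_poly n A p) \<le> \<epsilon>"
proof -
  have ha: "h \<in> nc_alg N R" and hs: "nc_star N R h = h" using h by (auto simp: nc_alg_sa_def)
  obtain p where p: "p \<in> ncpolys N"
    "\<And>n A. (n, A) \<in> eval_dom N R \<Longrightarrow> op_norm (h (n, A) - eval_poly n A p) \<le> \<epsilon>"
    using nc_alg_approx[OF ha \<open>\<epsilon> > 0\<close>] by metis
  define q where "q = poly_scale (1 / 2) (p + poly_star p)"
  have "q \<in> ncpolys_sa N"
    using p(1) by (auto simp: ncpolys_sa_def q_def lookup_poly_scale lookup_add lookup_poly_star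
        intro!: poly_scale_ncpolys ncpolys_add poly_star_ncpolys)
  moreover have "op_norm (h (n, A) - eval_poly n A q) \<le> \<epsilon>" if dom: "(n, A) \<in> eval_dom N R" for n A
  proof -
    let ?h = "h (n, A)"
    have A: "A \<in> sa_balls N R n" using dom by (simp add: eval_dom_iff)
    note c = nc_alg_carrier[OF ha dom]
    have adj: "mat_adjoint ?h = ?h" using fun_cong[OF hs, of "(n, A)"] dom by (simp add: nc_star_def)
    have "?h - eval_poly n A q
      = (1 / 2) \<cdot>\<^sub>m ((?h - eval_poly n A p) + (mat_adjoint ?h - eval_poly n A (poly_star p)))"
      unfolding adj using c by (intro eq_matI) (auto simp: q_def eval_poly_scale eval_poly_add field_simps)
    also have "op_norm \<dots> \<le> cmod (1 / 2)
      * op_norm ((?h - eval_poly n A p) + (mat_adjoint ?h - eval_poly n A (poly_star p)))"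
      by (rule op_norm_smult)
    also have "\<dots> \<le> cmod (1 / 2)
      * (op_norm (?h - eval_poly n A p) + op_norm (mat_adjoint ?h - eval_poly n A (poly_star p)))"
      using c adj by (intro mult_left_mono op_norm_add[of _ n n]) auto
    also have "\<dots> \<le> cmod (1 / 2) * (\<epsilon> + \<epsilon>)"
      using order_trans[OF op_norm_adjoint_diff_poly_star[OF c p(1) A] p(2)[OF dom]] p(2)[OF dom]
      by (intro mult_left_mono add_mono) auto
    finally show ?thesis by simp
  qed
  ultimately show ?thesis using that by blast
qed

section \<open>Lebesgue measure on balls of selfadjoint matrices\<close>

lemma space_sa_borel [simp]: "space (sa_borel n) = sa_mats n"
  unfolding sa_borel_def by (rule space_measure_of) auto

lemma sa_mats_iff:
  "A \<in> sa_mats n \<longleftrightarrow> A \<in> carrier_mat n n \<and> (\<forall>i<n. \<forall>j<n. A $$ (i, j) = cnj (A $$ (j, i)))"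
proof (cases "A \<in> carrier_mat n n")
  case True
  have "mat_adjoint A = A \<longleftrightarrow> (\<forall>i<n. \<forall>j<n. mat_adjoint A $$ (i, j) = A $$ (i, j))"
    using True mat_adjoint_carrier[OF True] eq_matI[of A "mat_adjoint A"] by auto
  also have "\<dots> \<longleftrightarrow> (\<forall>i<n. \<forall>j<n. A $$ (i, j) = cnj (A $$ (j, i)))"
    using index_mat_adjoint[OF True] by metis
  finally show ?thesis using True by (simp add: sa_mats_def)
qed (simp add: sa_mats_def)

lemma sa_mats_carrier: "A \<in> sa_mats n \<Longrightarrow> A \<in> carrier_mat n n"
  by (simp add: sa_mats_def)

lemma measurable_entry:
  assumes "i < n" "j < n"
  shows "(\<lambda>A. A $$ (i, j)) \<in> borel_measurable (sa_borel n)"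
proof (rule measurableI)
  fix B :: "complex set" assume "B \<in> sets borel"
  then have "{A \<in> sa_mats n. A $$ (i, j) \<in> B} \<in> sets (sa_borel n)"
    unfolding sa_borel_def using assms by (intro in_measure_of) auto
  then show "(\<lambda>A. A $$ (i, j)) -` B \<inter> space (sa_borel n) \<in> sets (sa_borel n)"
    by (simp add: vimage_def Int_def conj_commute)
qed simp

abbreviation coords :: "nat \<Rightarrow> (nat \<times> nat \<Rightarrow> real) measure" where
  "coords n \<equiv> PiM ({..<n} \<times> {..<n}) (\<lambda>_. lborel)"

lemma sa_of_coords_sa_mats: "sa_of_coords n f \<in> sa_mats n"
  unfolding sa_mats_iff by (auto simp: sa_of_coords_def complex_eq_iff)

lemma measurable_sa_of_coords [measurable]: "sa_of_coords n \<in> measurable (coords n) (sa_borel n)"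
  unfolding sa_borel_def
proof (rule measurable_measure_of)
  fix S assume "S \<in> {{A \<in> sa_mats n. A $$ (i, j) \<in> B} |i j B. i < n \<and> j < n \<and> B \<in> sets borel}"
  then obtain i j B where S: "S = {A \<in> sa_mats n. A $$ (i, j) \<in> B}" and ij: "i < n" "j < n"
    and [measurable]: "B \<in> sets borel" by auto
  have c [measurable]: "(\<lambda>f. f (k, l)) \<in> borel_measurable (coords n)" if "k < n" "l < n" for k l
    using measurable_component_singleton[of "(k, l)" "{..<n} \<times> {..<n}" "\<lambda>_. lborel"] that by simp
  have "(\<lambda>f. sa_of_coords n f $$ (i, j)) \<in> borel_measurable (coords n)"
  proof -
    consider "i = j" | "i < j" | "j < i" by linarith
    then show ?thesis
      using ij c[OF ij] c[OF ij(2,1)]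
      by cases (simp_all add: sa_of_coords_def Complex_eq)
  qed
  then have "(\<lambda>f. sa_of_coords n f $$ (i, j)) -` B \<inter> space (coords n) \<in> sets (coords n)"
    by (rule measurable_sets) simp
  moreover have "sa_of_coords n -` S \<inter> space (coords n)
      = (\<lambda>f. sa_of_coords n f $$ (i, j)) -` B \<inter> space (coords n)"
    using sa_of_coords_sa_mats by (auto simp: S)
  ultimately show "sa_of_coords n -` S \<inter> space (coords n) \<in> sets (coords n)" by simp
qed (use sa_of_coords_sa_mats in auto)

lemma sets_Lambda [measurable_cong, simp]: "sets (Lambda n) = sets (sa_borel n)"
  by (simp add: Lambda_def)

lemma space_Lambda [simp]: "space (Lambda n) = sa_mats n"
  by (simp add: Lambda_def)

text \<open>Boxes have an explicit volume, being cubes in the real coordinates. The volumes of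
  operator norm balls are controlled by comparison with them.\<close>

definition sa_box :: "nat \<Rightarrow> real \<Rightarrow> complex mat set" where
  "sa_box n c = {A \<in> sa_mats n. \<forall>i<n. \<forall>j<n. \<bar>Re (A $$ (i, j))\<bar> \<le> c \<and> \<bar>Im (A $$ (i, j))\<bar> \<le> c}"

lemma sa_box_sets [measurable]: "sa_box n c \<in> sets (sa_borel n)"
proof -
  have [measurable]: "Measurable.pred (sa_borel n) (\<lambda>A. \<bar>Re (A $$ (i, j))\<bar> \<le> c \<and> \<bar>Im (A $$ (i, j))\<bar> \<le> c)"
    if "i < n" "j < n" for i j
  proof -
    note [measurable] = measurable_entry[OF that]
    show ?thesis by measurable
  qed
  have "{A \<in> space (sa_borel n). \<forall>i\<in>{..<n}. \<forall>j\<in>{..<n}. \<bar>Re (A $$ (i, j))\<bar> \<le> c \<and> \<bar>Im (A $$ (i, j))\<bar> \<le> c}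
      \<in> sets (sa_borel n)" (is "?S \<in> _")
    by measurable
  moreover have "sa_box n c = ?S"
    unfolding sa_box_def space_sa_borel by blast
  ultimately show ?thesis by (simp only:)
qed

text \<open>Each coordinate occurs as the real or imaginary part of some entry, and every such part
  is a coordinate up to sign, or zero. Symmetry of the interval absorbs the sign, and
  \<open>0 \<le> c\<close> the vanishing imaginary parts on the diagonal.\<close>

lemma vimage_sa_box:
  assumes "0 \<le> c"
  shows "sa_of_coords n -` sa_box n c \<inter> space (coords n) = (\<Pi>\<^sub>E x\<in>{..<n} \<times> {..<n}. {-c..c})"
proof (intro Set.set_eqI iffI)
  fix f assume f: "f \<in> sa_of_coords n -` sa_box n c \<inter> space (coords n)"
  have "\<bar>f (i, j)\<bar> \<le> c" if ij: "i < n" "j < n" for i j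
  proof -
    let ?A = "sa_of_coords n f"
    have b: "\<bar>Re (?A $$ (k, l))\<bar> \<le> c" "\<bar>Im (?A $$ (k, l))\<bar> \<le> c" if "k < n" "l < n" for k l
      using f that by (auto simp: sa_box_def)
    consider "i = j" | "i < j" | "j < i" by linarith
    then show ?thesis
      using b[OF ij] b[OF ij(2,1)] ij by cases (auto simp: sa_of_coords_def)
  qed
  then have abs_le: "\<bar>f x\<bar> \<le> c" if "x \<in> {..<n} \<times> {..<n}" for x
    using that by (cases x) simp
  have "f x \<in> {-c..c}" if "x \<in> {..<n} \<times> {..<n}" for x
    using abs_le[OF that] by (simp add: abs_le_iff)
  then show "f \<in> (\<Pi>\<^sub>E x\<in>{..<n} \<times> {..<n}. {-c..c})"
    using f by (simp add: space_PiM PiE_iff)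
next
  fix f assume f: "f \<in> (\<Pi>\<^sub>E x\<in>{..<n} \<times> {..<n}. {-c..c})"
  then have b: "\<bar>f (i, j)\<bar> \<le> c" if "i < n" "j < n" for i j
    using that by (auto simp: PiE_iff abs_le_iff minus_le_iff)
  have "sa_of_coords n f \<in> sa_box n c"
    using b assms sa_of_coords_sa_mats by (auto simp: sa_box_def sa_of_coords_def)
  then show "f \<in> sa_of_coords n -` sa_box n c \<inter> space (coords n)"
    using f by (auto simp: space_PiM PiE_iff)
qed

lemma emeasure_sa_box:
  assumes "0 \<le> c"
  shows "emeasure (Lambda n) (sa_box n c) = ennreal (2 ^ (n * (n - 1) div 2) * (2 * c) ^ (n * n))"
proof -
  interpret product_sigma_finite "\<lambda>_ :: nat \<times> nat. lborel :: real measure" ..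
  have "emeasure (coords n) (\<Pi>\<^sub>E x\<in>{..<n} \<times> {..<n}. {-c..c}) = (\<Prod>x\<in>{..<n} \<times> {..<n}. emeasure lborel {-c..c})"
    by (rule emeasure_PiM) auto
  also have "\<dots> = ennreal ((2 * c) ^ (n * n))"
    using assms by (simp add: card_cartesian_product ennreal_power)
  finally have *: "emeasure (coords n) (\<Pi>\<^sub>E x\<in>{..<n} \<times> {..<n}. {-c..c}) = ennreal ((2 * c) ^ (n * n))" .
  have "emeasure (Lambda n) (sa_box n c)
      = 2 ^ (n * (n - 1) div 2) * emeasure (coords n) (sa_of_coords n -` sa_box n c \<inter> space (coords n))"
    unfolding Lambda_def by (subst emeasure_distr) (auto simp: space_scale_measure)
  also have "\<dots> = ennreal (2 ^ (n * (n - 1) div 2)) * ennreal ((2 * c) ^ (n * n))"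
    unfolding vimage_sa_box[OF assms] * by (simp add: ennreal_power flip: ennreal_numeral)
  finally show ?thesis using assms by (simp add: ennreal_mult)
qed

text \<open>Boxes of integer size exhaust the selfadjoint matrices. Sigma-finiteness lets the
  product measure of a product of balls be computed factor by factor.\<close>

lemma sigma_finite_Lambda: "sigma_finite_measure (Lambda n)"
proof
  let ?C = "range (\<lambda>k::nat. sa_box n (real k))"
  have "A \<in> \<Union>?C" if A: "A \<in> sa_mats n" for A
  proof -
    obtain k :: nat where k: "op_norm A \<le> real k" using real_arch_simple by blast
    have "A \<in> sa_box n (real k)"
    proof -
      have "\<bar>Re (A $$ (i, j))\<bar> \<le> real k \<and> \<bar>Im (A $$ (i, j))\<bar> \<le> real k" if "i < n" "j < n" for i j
        using norm_entry_le_op_norm[OF sa_mats_carrier[OF A] that] k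
          abs_Re_le_cmod[of "A $$ (i, j)"] abs_Im_le_cmod[of "A $$ (i, j)"] by linarith
      then show ?thesis using A by (simp add: sa_box_def)
    qed
    then show ?thesis by auto
  qed
  then have "\<Union>?C = space (Lambda n)" by (auto simp: sa_box_def)
  then show "\<exists>C. countable C \<and> C \<subseteq> sets (Lambda n) \<and> \<Union> C = space (Lambda n)
      \<and> (\<forall>a\<in>C. emeasure (Lambda n) a \<noteq> \<infinity>)"
    by (intro exI[of _ ?C]) (auto simp: emeasure_sa_box)
qed

section \<open>Operator norm balls: measurability and volume\<close>

definition sa_ball :: "nat \<Rightarrow> real \<Rightarrow> complex mat set" where
  "sa_ball n R = {A \<in> sa_mats n. op_norm A \<le> R}"

lemma vnorm_mult_mat_vec_eq:
  assumes "A \<in> carrier_mat n n"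
  shows "vnorm (A *\<^sub>v vec n f) = L2_set (\<lambda>i. cmod (\<Sum>j<n. A $$ (i, j) * f j)) {..<n}"
  unfolding vnorm_def using assms
  by (auto simp: index_mult_mat_vec_sum[of A n n] simp del: index_mult_mat_vec intro!: L2_set_cong)

lemma vnorm_vec: "vnorm (vec n f) = L2_set (\<lambda>i. cmod (f i)) {..<n}"
  unfolding vnorm_def by (auto intro!: L2_set_cong)

text \<open>Testing the operator norm on a countable dense set of vectors makes the ball a countable
  intersection of measurable sets.\<close>

lemma sa_ball_sets [measurable]:
  assumes "0 \<le> R"
  shows "sa_ball n R \<in> sets (sa_borel n)"
proof -
  obtain D :: "complex set" where D: "countable D" "\<And>X. open X \<Longrightarrow> X \<noteq> {} \<Longrightarrow> \<exists>d\<in>D. d \<in> X"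
    using countable_dense_exists by blast
  let ?V = "{..<n} \<rightarrow>\<^sub>E D"
  let ?P = "\<lambda>f A. L2_set (\<lambda>i. cmod (\<Sum>j<n. A $$ (i, j) * f j)) {..<n}
      \<le> R * L2_set (\<lambda>i. cmod (f i)) {..<n}"
  have "countable ?V" using D(1) by (intro countable_PiE) auto
  have meas: "{A \<in> sa_mats n. ?P f A} \<in> sets (sa_borel n)" for f
  proof -
    have [measurable]: "(\<lambda>A. \<Sum>j<n. A $$ (i, j) * f j) \<in> borel_measurable (sa_borel n)" if "i < n" for i
      using that by (intro borel_measurable_sum borel_measurable_times measurable_entry) auto
    have "(\<lambda>A. L2_set (\<lambda>i. cmod (\<Sum>j<n. A $$ (i, j) * f j)) {..<n}) \<in> borel_measurable (sa_borel n)"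
      unfolding L2_set_def by (intro measurable_compose[OF _ borel_measurable_sqrt] borel_measurable_sum
          borel_measurable_power borel_measurable_norm) auto
    then have "{A \<in> space (sa_borel n). ?P f A} \<in> sets (sa_borel n)" by measurable
    then show ?thesis by simp
  qed
  have "A \<in> sa_ball n R \<longleftrightarrow> (\<forall>f\<in>?V. ?P f A)" if A: "A \<in> sa_mats n" for A
  proof
    assume "A \<in> sa_ball n R"
    then have "vnorm (A *\<^sub>v vec n f) \<le> R * vnorm (vec n f)" for f
      using vnorm_mult_mat_vec_le[of "vec n f" A] sa_mats_carrier[OF A]
        mult_right_mono[OF _ vnorm_nonneg, of "op_norm A" R "vec n f"]
      by (auto simp: sa_ball_def)
    then show "\<forall>f\<in>?V. ?P f A"
      by (simp add: vnorm_mult_mat_vec_eq[OF sa_mats_carrier[OF A]] vnorm_vec)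
  next
    assume V: "\<forall>f\<in>?V. ?P f A"
    \<comment> \<open>Both sides depend continuously on the finitely many entries of the test vector
      and the inequality is not strict, so it passes from entries in \<open>D\<close> to arbitrary
      ones.\<close>
    have P: "?P f A" for f
    proof -
      have "\<exists>d\<in>D. d \<in> ball (f i) (1 / real (Suc k))" for i k
        by (rule D(2)) auto
      then obtain d where d: "\<And>i k. d i k \<in> D" "\<And>i k. dist (f i) (d i k) < 1 / real (Suc k)"
        by (auto simp: Bex_def) metis
      have lim: "(\<lambda>k. d i k) \<longlonglongrightarrow> f i" for i
      proof (rule tendstoI)
        fix e :: real assume "e > 0"
        then have "\<forall>\<^sub>F k in sequentially. 1 / real (Suc k) < e"
          using order_tendstoD(2)[OF LIMSEQ_inverse_real_of_nat] by (simp add: inverse_eq_divide)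
        then show "\<forall>\<^sub>F k in sequentially. dist (d i k) (f i) < e"
          by eventually_elim (use d(2) in \<open>metis dist_commute less_trans\<close>)
      qed
      have "?P (\<lambda>i. d i k) A" for k
      proof -
        have "restrict (\<lambda>i. d i k) {..<n} \<in> ?V" using d(1) by auto
        from V[rule_format, OF this] show ?thesis by (simp cong: L2_set_cong_simp sum.cong_simp)
      qed
      moreover have "(\<lambda>k. L2_set (\<lambda>i. cmod (\<Sum>j<n. A $$ (i, j) * d j k)) {..<n})
          \<longlonglongrightarrow> L2_set (\<lambda>i. cmod (\<Sum>j<n. A $$ (i, j) * f j)) {..<n}"
        unfolding L2_set_def by (intro tendsto_intros lim)
      moreover have "(\<lambda>k. R * L2_set (\<lambda>i. cmod (d i k)) {..<n}) \<longlonglongrightarrow> R * L2_set (\<lambda>i. cmod (f i)) {..<n}"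
        unfolding L2_set_def by (intro tendsto_intros lim)
      ultimately show ?thesis by (intro LIMSEQ_le) auto
    qed
    have "op_norm A \<le> R"
    proof (rule op_norm_le)
      fix v :: "complex vec" assume "v \<in> carrier_vec (dim_col A)"
      then have "v = vec n (\<lambda>i. v $ i)" using sa_mats_carrier[OF A] by auto
      then show "vnorm (A *\<^sub>v v) \<le> R * vnorm v"
        using P[of "\<lambda>i. v $ i"] vnorm_mult_mat_vec_eq[OF sa_mats_carrier[OF A], of "\<lambda>i. v $ i"]
          vnorm_vec[of n "\<lambda>i. v $ i"] by simp
    qed (rule assms)
    then show "A \<in> sa_ball n R" using A by (simp add: sa_ball_def)
  qed
  then have eq: "sa_ball n R = {A \<in> space (sa_borel n). \<forall>f\<in>?V. ?P f A}"
    by (auto simp: sa_ball_def)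
  show ?thesis
    unfolding eq using \<open>countable ?V\<close> meas
    by (intro sets.sets_Collect_countable_All') (simp_all only: space_sa_borel)
qed

text \<open>The ball is sandwiched between two boxes: each entry is at most the operator norm, which
  is at most the sum of the moduli of all entries.\<close>

lemma emeasure_sa_ball:
  assumes "R > 0"
  shows "emeasure (Lambda n) (sa_ball n R) \<noteq> \<infinity>" "emeasure (Lambda n) (sa_ball n R) \<noteq> 0"
proof -
  have "sa_ball n R \<subseteq> sa_box n R"
  proof
    fix A assume A: "A \<in> sa_ball n R"
    then have "\<bar>Re (A $$ (i, j))\<bar> \<le> R \<and> \<bar>Im (A $$ (i, j))\<bar> \<le> R" if "i < n" "j < n" for i j
      using norm_entry_le_op_norm[OF _ that, of A] abs_Re_le_cmod[of "A $$ (i, j)"]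
        abs_Im_le_cmod[of "A $$ (i, j)"] by (force simp: sa_ball_def sa_mats_carrier)
    then show "A \<in> sa_box n R" using A by (simp add: sa_box_def sa_ball_def)
  qed
  then have "emeasure (Lambda n) (sa_ball n R) \<le> emeasure (Lambda n) (sa_box n R)"
    by (intro emeasure_mono) auto
  also have "\<dots> < \<infinity>" using assms by (simp add: emeasure_sa_box)
  finally show "emeasure (Lambda n) (sa_ball n R) \<noteq> \<infinity>" by simp
  \<comment> \<open>Entries in this smaller box have modulus at most \<open>2 * c\<close>, and there
    are \<open>n * n\<close> of them; the extra 1 keeps the divisor positive for
    \<open>n = 0\<close>.\<close>
  define c where "c = R / (2 * (real n * real n + 1))"
  have "2 * (real n * real n + 1) > 0" by (smt (verit) mult_nonneg_nonneg of_nat_0_le_iff)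
  then have c: "c > 0" and cR: "real n * real n * (2 * c) \<le> R"
    using assms by (auto simp: c_def divide_simps)
  have "sa_box n c \<subseteq> sa_ball n R"
  proof
    fix A assume A: "A \<in> sa_box n c"
    then have carrier: "A \<in> carrier_mat n n" by (simp add: sa_box_def sa_mats_carrier)
    have "op_norm A \<le> (\<Sum>i<n. \<Sum>j<n. cmod (A $$ (i, j)))" by (rule op_norm_le_sum[OF carrier])
    also have "\<dots> \<le> (\<Sum>i<n. \<Sum>j<n. 2 * c)"
    proof (intro sum_mono)
      fix i j assume "i \<in> {..<n}" "j \<in> {..<n}"
      then have "\<bar>Re (A $$ (i, j))\<bar> \<le> c" "\<bar>Im (A $$ (i, j))\<bar> \<le> c" using A by (auto simp: sa_box_def)
      then show "cmod (A $$ (i, j)) \<le> 2 * c" using cmod_le[of "A $$ (i, j)"] by linarith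
    qed
    also have "\<dots> \<le> R" using cR by (simp add: mult.assoc)
    finally show "A \<in> sa_ball n R" using A by (simp add: sa_box_def sa_ball_def)
  qed
  then have "emeasure (Lambda n) (sa_box n c) \<le> emeasure (Lambda n) (sa_ball n R)"
    using assms by (intro emeasure_mono) (auto intro!: sa_ball_sets)
  moreover have "emeasure (Lambda n) (sa_box n c) > 0" using c by (simp add: emeasure_sa_box)
  ultimately show "emeasure (Lambda n) (sa_ball n R) \<noteq> 0" by auto
qed

lemma sa_balls_eq: "sa_balls N R n = (\<Pi>\<^sub>E i\<in>{..<N}. sa_ball n R)"
  by (simp add: sa_balls_def sa_ball_def)

lemma sa_balls_sets:
  assumes "R > 0"
  shows "sa_balls N R n \<in> sets (PiM {..<N} (\<lambda>_. Lambda n))"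
  unfolding sa_balls_eq using assms by (intro sets_PiM_I_finite) (auto intro!: sa_ball_sets)

lemma space_Lambda_ball:
  assumes "R > 0"
  shows "space (Lambda_ball N R n) = sa_balls N R n"
  unfolding Lambda_ball_def by (rule space_restrict_space2[OF sa_balls_sets[OF assms]])

text \<open>Finite mass makes bounded measurable functions integrable; nonzero mass makes the
  partition function positive.\<close>

lemma emeasure_Lambda_ball:
  assumes "R > 0"
  shows "emeasure (Lambda_ball N R n) (space (Lambda_ball N R n)) \<noteq> \<infinity>"
    "emeasure (Lambda_ball N R n) (space (Lambda_ball N R n)) \<noteq> 0"
proof -
  interpret L: sigma_finite_measure "Lambda n" by (rule sigma_finite_Lambda)
  interpret product_sigma_finite "\<lambda>_ :: nat. Lambda n" ..
  have "emeasure (Lambda_ball N R n) (space (Lambda_ball N R n))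
      = emeasure (PiM {..<N} (\<lambda>_. Lambda n)) (sa_balls N R n)"
    unfolding space_Lambda_ball[OF assms] unfolding Lambda_ball_def
    using sa_balls_sets[OF assms] by (subst emeasure_restrict_space) (auto dest: sets.sets_into_space)
  also have "\<dots> = (\<Prod>i<N. emeasure (Lambda n) (sa_ball n R))"
    unfolding sa_balls_eq using assms by (intro emeasure_PiM) (auto intro!: sa_ball_sets)
  finally have eq: "emeasure (Lambda_ball N R n) (space (Lambda_ball N R n))
      = emeasure (Lambda n) (sa_ball n R) ^ N" by simp
  show "emeasure (Lambda_ball N R n) (space (Lambda_ball N R n)) \<noteq> \<infinity>"
    "emeasure (Lambda_ball N R n) (space (Lambda_ball N R n)) \<noteq> 0"
    unfolding eq using emeasure_sa_ball[OF assms, of n]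
    by (auto simp: power_eq_top_ennreal)
qed

section \<open>Measurability of evaluations\<close>

lemma measurable_Lambda_ball_entry:
  assumes "k < N" "i < n" "j < n"
  shows "(\<lambda>A. A k $$ (i, j)) \<in> borel_measurable (Lambda_ball N R n)"
proof -
  have "(\<lambda>A. A k) \<in> measurable (PiM {..<N} (\<lambda>_. Lambda n)) (Lambda n)"
    using assms by (intro measurable_component_singleton) auto
  then have "(\<lambda>A. A k) \<in> measurable (PiM {..<N} (\<lambda>_. Lambda n)) (sa_borel n)"
    by (simp cong: measurable_cong_sets)
  then have "(\<lambda>A. A k $$ (i, j)) \<in> borel_measurable (PiM {..<N} (\<lambda>_. Lambda n))"
    using measurable_compose measurable_entry[OF assms(2,3)] by blast
  then show ?thesis unfolding Lambda_ball_def by (rule measurable_restrict_space1)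
qed

lemma measurable_eval_word_entry:
  assumes "R > 0" "set w \<subseteq> {..<N}" "i < n" "j < n"
  shows "(\<lambda>A. eval_word n A w $$ (i, j)) \<in> borel_measurable (Lambda_ball N R n)"
  using assms(2-4)
proof (induction w arbitrary: i j)
  case Nil
  then show ?case by simp
next
  case (Cons k w)
  have "(\<lambda>A. \<Sum>l<n. A k $$ (i, l) * eval_word n A w $$ (l, j)) \<in> borel_measurable (Lambda_ball N R n)"
    using Cons by (intro borel_measurable_sum borel_measurable_times measurable_Lambda_ball_entry) auto
  moreover have "eval_word n A (k # w) $$ (i, j) = (\<Sum>l<n. A k $$ (i, l) * eval_word n A w $$ (l, j))"
    if "A \<in> space (Lambda_ball N R n)" for A
  proof -
    have A: "A \<in> sa_balls N R n" using that by (simp add: space_Lambda_ball[OF assms(1)])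
    have kw: "k < N" "set w \<subseteq> {..<N}" using Cons.prems by auto
    show ?thesis
      unfolding eval_word_simps using sa_ballsD(1)[OF A] kw Cons.prems
      by (intro index_mult_mat_sum[of _ n n _ n] eval_word_carrier) auto
  qed
  ultimately show ?case by (subst measurable_cong) auto
qed

text \<open>Entries of polynomial values are measurable, and a difference of entries is dominated by
  the operator norm of the difference; so the entries of \<open>h\<close> are pointwise limits of
  measurable functions.\<close>

lemma measurable_nc_alg_entry:
  assumes "R > 0" and h: "h \<in> nc_alg N R" and "i < n" "j < n"
  shows "(\<lambda>A. h (n, A) $$ (i, j)) \<in> borel_measurable (Lambda_ball N R n)"
proof -
  have "\<exists>p. p \<in> ncpolys N \<and> (\<forall>n A. (n, A) \<in> eval_dom N R \<longrightarrow>
      op_norm (h (n, A) - eval_poly n A p) \<le> 1 / real (Suc k))" for k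
  proof -
    have "1 / real (Suc k) > 0" by simp
    from nc_alg_approx[OF h this] show ?thesis by metis
  qed
  then obtain p where p: "\<And>k. p k \<in> ncpolys N" "\<And>k n A. (n, A) \<in> eval_dom N R \<Longrightarrow>
      op_norm (h (n, A) - eval_poly n A (p k)) \<le> 1 / real (Suc k)" by metis
  show ?thesis
  proof (rule borel_measurable_LIMSEQ_metric)
    fix k
    have "(\<lambda>A. \<Sum>w\<in>Poly_Mapping.keys (p k). Poly_Mapping.lookup (p k) w * eval_word n A w $$ (i, j))
        \<in> borel_measurable (Lambda_ball N R n)"
      using assms ncpolys_keysD[OF p(1)] unfolding in_lists_conv_set subset_iff[symmetric]
      by (intro borel_measurable_sum borel_measurable_times measurable_eval_word_entry) auto
    then show "(\<lambda>A. eval_poly n A (p k) $$ (i, j)) \<in> borel_measurable (Lambda_ball N R n)"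
      using assms by (simp add: eval_poly_index[where S = "Poly_Mapping.keys (p k)"])
  next
    fix A assume "A \<in> space (Lambda_ball N R n)"
    then have dom: "(n, A) \<in> eval_dom N R"
      using assms by (auto simp: space_Lambda_ball eval_dom_iff)
    have b: "cmod (eval_poly n A (p k) $$ (i, j) - h (n, A) $$ (i, j)) \<le> inverse (real (Suc k))" for k
    proof -
      have "cmod (eval_poly n A (p k) $$ (i, j) - h (n, A) $$ (i, j))
          = cmod ((h (n, A) - eval_poly n A (p k)) $$ (i, j))"
        using assms nc_alg_carrier[OF h dom] by (simp add: norm_minus_commute)
      also have "\<dots> \<le> op_norm (h (n, A) - eval_poly n A (p k))"
        using assms by (intro norm_entry_le_op_norm[of _ n n]) auto
      also have "\<dots> \<le> inverse (real (Suc k))" using p(2)[OF dom] by (simp add: inverse_eq_divide)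
      finally show ?thesis .
    qed
    have "(\<lambda>k. eval_poly n A (p k) $$ (i, j) - h (n, A) $$ (i, j)) \<longlonglongrightarrow> 0"
      by (rule Lim_null_comparison[OF _ LIMSEQ_inverse_real_of_nat]) (use b in auto)
    then show "(\<lambda>k. eval_poly n A (p k) $$ (i, j)) \<longlonglongrightarrow> h (n, A) $$ (i, j)"
      by (simp add: LIM_zero_iff)
  qed
qed

lemma measurable_ntr_nc_alg:
  assumes "R > 0" and h: "h \<in> nc_alg N R" and "n \<ge> 1"
  shows "(\<lambda>A. ntr (h (n, A))) \<in> borel_measurable (Lambda_ball N R n)"
proof -
  have "(\<lambda>A. (\<Sum>i<n. h (n, A) $$ (i, i)) / of_nat n) \<in> borel_measurable (Lambda_ball N R n)"
    using assms by (intro borel_measurable_divide borel_measurable_sum measurable_nc_alg_entry) auto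
  moreover have "ntr (h (n, A)) = (\<Sum>i<n. h (n, A) $$ (i, i)) / of_nat n"
    if "A \<in> space (Lambda_ball N R n)" for A
    using nc_alg_carrier[OF h, of n A] that assms by (auto simp: space_Lambda_ball eval_dom_iff ntr_def)
  ultimately show ?thesis by (subst measurable_cong) auto
qed

section \<open>Gibbs states on matrix tuples\<close>

definition gibbs_density :: "nat \<Rightarrow> real \<Rightarrow> ncfun \<Rightarrow> nat \<Rightarrow> (nat \<Rightarrow> complex mat) \<Rightarrow> real" where
  "gibbs_density N R h n A = exp (- pressure N R n h) * gibbs_weight h n A"

text \<open>The mean of the normalized trace of \<open>a\<close> under the Gibbs measure, written
  against the base measure so that the states of different \<open>h\<close> are integrals over the
  same space. The restriction to the algebra matches the extensional functions in
  \<open>tracial_states\<close>.\<close>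

definition gibbs_state :: "nat \<Rightarrow> real \<Rightarrow> ncfun \<Rightarrow> nat \<Rightarrow> ncfun \<Rightarrow> complex" where
  "gibbs_state N R h n = (\<lambda>a \<in> nc_alg N R.
     LINT A|Lambda_ball N R n. complex_of_real (gibbs_density N R h n A) * ntr (a (n, A)))"

context
  fixes N :: nat and R :: real and n :: nat
  assumes R: "R > 0" and n: "n \<ge> 1"
begin

interpretation finite_measure "Lambda_ball N R n"
  by (rule finite_measureI) (rule emeasure_Lambda_ball(1)[OF R])

lemma space_eval_dom: "A \<in> space (Lambda_ball N R n) \<Longrightarrow> (n, A) \<in> eval_dom N R"
  using n by (simp add: space_Lambda_ball[OF R] eval_dom_iff)

lemma integrable_bounded:
  fixes F :: "_ \<Rightarrow> 'b :: {banach, second_countable_topology}"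
  assumes "F \<in> borel_measurable (Lambda_ball N R n)"
    and "\<And>A. A \<in> space (Lambda_ball N R n) \<Longrightarrow> norm (F A) \<le> C"
  shows "integrable (Lambda_ball N R n) F"
  by (rule integrable_const_bound[where B = C]) (use assms in auto)

lemma norm_ntr_bounded:
  assumes a: "a \<in> nc_alg N R"
  obtains C where "\<And>A. A \<in> space (Lambda_ball N R n) \<Longrightarrow> cmod (ntr (a (n, A))) \<le> C"
proof -
  obtain C where C: "\<And>n A. (n, A) \<in> eval_dom N R \<Longrightarrow> op_norm (a (n, A)) \<le> C"
    using nc_alg_bounded[OF a] R by (metis less_imp_le)
  have "cmod (ntr (a (n, A))) \<le> C" if "A \<in> space (Lambda_ball N R n)" for A
    using norm_ntr_le_op_norm[OF nc_alg_carrier[OF a space_eval_dom[OF that]]]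
      C[OF space_eval_dom[OF that]] by simp
  then show ?thesis using that by blast
qed

section \<open>Partition function and Gibbs density\<close>

lemma measurable_gibbs_weight:
  assumes h: "h \<in> nc_alg N R"
  shows "gibbs_weight h n \<in> borel_measurable (Lambda_ball N R n)"
proof -
  note [measurable] = measurable_ntr_nc_alg[OF R h n]
  show ?thesis unfolding gibbs_weight_def by measurable
qed

lemma gibbs_weight_bounded:
  assumes h: "h \<in> nc_alg N R"
  obtains C where "\<And>A. A \<in> space (Lambda_ball N R n) \<Longrightarrow> gibbs_weight h n A \<le> C"
proof -
  obtain C where C: "\<And>A. A \<in> space (Lambda_ball N R n) \<Longrightarrow> cmod (ntr (h (n, A))) \<le> C"
    using norm_ntr_bounded[OF h] by blast
  have "gibbs_weight h n A \<le> exp ((real n)\<^sup>2 * C)" if "A \<in> space (Lambda_ball N R n)" for A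
  proof -
    have "- Re (ntr (h (n, A))) \<le> C" using C[OF that] abs_Re_le_cmod[of "ntr (h (n, A))"] by linarith
    then have "(real n)\<^sup>2 * (- Re (ntr (h (n, A)))) \<le> (real n)\<^sup>2 * C" by (intro mult_left_mono) auto
    then show ?thesis by (simp add: gibbs_weight_def)
  qed
  then show ?thesis using that by blast
qed

lemma gibbs_weight_pos: "gibbs_weight h n A > 0"
  by (simp add: gibbs_weight_def)

lemma integrable_gibbs_weight:
  assumes h: "h \<in> nc_alg N R"
  shows "integrable (Lambda_ball N R n) (gibbs_weight h n)"
proof -
  obtain C where "\<And>A. A \<in> space (Lambda_ball N R n) \<Longrightarrow> gibbs_weight h n A \<le> C"
    using gibbs_weight_bounded[OF h] by blast
  then show ?thesis
    using gibbs_weight_pos[of h] measurable_gibbs_weight[OF h]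
    by (intro integrable_bounded[where C = C]) (auto simp: less_imp_le)
qed

text \<open>A positive function with zero integral would force the space to be null. Positivity
  makes \<open>ln\<close> in \<open>pressure\<close> a genuine logarithm, so that exponentiating
  recovers the partition function.\<close>

lemma integral_gibbs_weight_pos:
  assumes h: "h \<in> nc_alg N R"
  shows "(LINT A|Lambda_ball N R n. gibbs_weight h n A) > 0"
proof -
  have nonneg: "0 \<le> (LINT A|Lambda_ball N R n. gibbs_weight h n A)"
    by (intro integral_nonneg) (simp add: gibbs_weight_pos less_imp_le)
  have "(LINT A|Lambda_ball N R n. gibbs_weight h n A) \<noteq> 0"
  proof
    assume "(LINT A|Lambda_ball N R n. gibbs_weight h n A) = 0"
    then have "AE A in Lambda_ball N R n. gibbs_weight h n A = 0"
      using integrable_gibbs_weight[OF h]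
      by (subst (asm) integral_nonneg_eq_0_iff_AE) (auto simp: gibbs_weight_pos less_imp_le)
    then have "AE A in Lambda_ball N R n. False"
      by eventually_elim (metis gibbs_weight_pos less_irrefl)
    then have "emeasure (Lambda_ball N R n) (space (Lambda_ball N R n)) = 0"
      by (simp add: AE_iff_null null_setsD1)
    then show False using emeasure_Lambda_ball(2)[OF R] by simp
  qed
  then show ?thesis using nonneg by simp
qed

lemma exp_pressure:
  assumes h: "h \<in> nc_alg N R"
  shows "exp (pressure N R n h) = (LINT A|Lambda_ball N R n. gibbs_weight h n A)"
  unfolding pressure_def using integral_gibbs_weight_pos[OF h] by simp

lemma gibbs_density_pos: "gibbs_density N R h n A > 0"
  by (simp add: gibbs_density_def gibbs_weight_pos)

lemma measurable_gibbs_density: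
  "h \<in> nc_alg N R \<Longrightarrow> gibbs_density N R h n \<in> borel_measurable (Lambda_ball N R n)"
  unfolding gibbs_density_def using measurable_gibbs_weight by (intro borel_measurable_times) auto

lemma integrable_gibbs_density:
  "h \<in> nc_alg N R \<Longrightarrow> integrable (Lambda_ball N R n) (gibbs_density N R h n)"
  unfolding gibbs_density_def using integrable_gibbs_weight by (intro integrable_mult_right) auto

lemma integral_gibbs_density:
  assumes h: "h \<in> nc_alg N R"
  shows "(LINT A|Lambda_ball N R n. gibbs_density N R h n A) = 1"
  unfolding gibbs_density_def by (simp add: exp_pressure[OF h, symmetric] exp_minus)

lemma integrable_gibbs_density_mult:
  fixes F :: "_ \<Rightarrow> 'b :: {real_normed_field, banach, second_countable_topology}"
  assumes h: "h \<in> nc_alg N R" and F: "F \<in> borel_measurable (Lambda_ball N R n)"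
    and C: "\<And>A. A \<in> space (Lambda_ball N R n) \<Longrightarrow> norm (F A) \<le> C"
  shows "integrable (Lambda_ball N R n) (\<lambda>A. of_real (gibbs_density N R h n A) * F A)"
proof (rule Bochner_Integration.integrable_bound)
  show "integrable (Lambda_ball N R n) (\<lambda>A. C * gibbs_density N R h n A)"
    using integrable_gibbs_density[OF h] by simp
  note [measurable] = F measurable_gibbs_density[OF h]
  show "(\<lambda>A. of_real (gibbs_density N R h n A) * F A) \<in> borel_measurable (Lambda_ball N R n)"
    by measurable
  show "AE A in Lambda_ball N R n. norm (of_real (gibbs_density N R h n A) * F A)
      \<le> norm (C * gibbs_density N R h n A)"
  proof (rule AE_I2)
    fix A assume "A \<in> space (Lambda_ball N R n)"
    then have "norm (F A) \<le> \<bar>C\<bar>" using C by (meson abs_ge_self order_trans)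
    then show "norm (of_real (gibbs_density N R h n A) * F A) \<le> norm (C * gibbs_density N R h n A)"
      using gibbs_density_pos[of h A]
      by (simp add: norm_mult abs_mult mult.commute[of C] mult_left_mono)
  qed
qed

section \<open>Gibbs means of the normalized trace\<close>

lemma integrable_gibbs_ntr:
  assumes h: "h \<in> nc_alg N R" and a: "a \<in> nc_alg N R"
  shows "integrable (Lambda_ball N R n) (\<lambda>A. complex_of_real (gibbs_density N R h n A) * ntr (a (n, A)))"
proof -
  obtain C where "\<And>A. A \<in> space (Lambda_ball N R n) \<Longrightarrow> cmod (ntr (a (n, A))) \<le> C"
    using norm_ntr_bounded[OF a] by blast
  then show ?thesis
    by (rule integrable_gibbs_density_mult[OF h measurable_ntr_nc_alg[OF R a n]])
qed

lemma integrable_gibbs_Re_ntr: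
  assumes h: "h \<in> nc_alg N R" and a: "a \<in> nc_alg N R"
  shows "integrable (Lambda_ball N R n) (\<lambda>A. gibbs_density N R h n A * Re (ntr (a (n, A))))"
  using integrable_Re[OF integrable_gibbs_ntr[OF h a]] by simp

lemma Re_gibbs_state:
  assumes h: "h \<in> nc_alg N R" and a: "a \<in> nc_alg N R"
  shows "Re (gibbs_state N R h n a) = (LINT A|Lambda_ball N R n. gibbs_density N R h n A * Re (ntr (a (n, A))))"
  using integral_Re[OF integrable_gibbs_ntr[OF h a]] a by (simp add: gibbs_state_def)

text \<open>A constant that bounds \<open>a\<close> in every dimension thus bounds the values at
  \<open>a\<close> of all Gibbs states; this puts them into one compact product of discs.\<close>

lemma norm_gibbs_state_le:
  assumes h: "h \<in> nc_alg N R" and a: "a \<in> nc_alg N R"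
    and C: "\<And>A. A \<in> sa_balls N R n \<Longrightarrow> op_norm (a (n, A)) \<le> C"
  shows "cmod (gibbs_state N R h n a) \<le> C"
proof -
  have "cmod (gibbs_state N R h n a)
      \<le> (LINT A|Lambda_ball N R n. cmod (complex_of_real (gibbs_density N R h n A) * ntr (a (n, A))))"
    using a by (simp add: gibbs_state_def del: norm_mult)
  also have "\<dots> \<le> (LINT A|Lambda_ball N R n. gibbs_density N R h n A * C)"
  proof (intro integral_mono integrable_norm integrable_gibbs_ntr h a integrable_mult_left
      integrable_gibbs_density)
    fix A assume A: "A \<in> space (Lambda_ball N R n)"
    then have "cmod (ntr (a (n, A))) \<le> C"
      using norm_ntr_le_op_norm[OF nc_alg_carrier[OF a space_eval_dom[OF A]]] C[of A]
      by (simp add: space_Lambda_ball[OF R])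
    then show "cmod (complex_of_real (gibbs_density N R h n A) * ntr (a (n, A)))
        \<le> gibbs_density N R h n A * C"
      using gibbs_density_pos[of h A] by (simp add: norm_mult mult_left_mono)
  qed
  also have "\<dots> = C" by (simp add: integral_gibbs_density[OF h])
  finally show ?thesis .
qed

text \<open>States are contractive. Real parts are compared because the pressure inequalities
  involve only these.\<close>

lemma Re_gibbs_state_le:
  assumes h: "h \<in> nc_alg N R" and a: "a \<in> nc_alg N R" and b: "b \<in> nc_alg N R"
    and ab: "\<And>A. (n, A) \<in> eval_dom N R \<Longrightarrow> op_norm (a (n, A) - b (n, A)) \<le> \<epsilon>"
  shows "\<bar>Re (gibbs_state N R h n a) - Re (gibbs_state N R h n b)\<bar> \<le> \<epsilon>"
proof -
  let ?M = "Lambda_ball N R n" and ?d = "gibbs_density N R h n"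
  note int = integrable_gibbs_density[OF h] integrable_gibbs_Re_ntr[OF h a] integrable_gibbs_Re_ntr[OF h b]
  have close: "\<bar>Re (ntr (a (n, A))) - Re (ntr (b (n, A)))\<bar> \<le> \<epsilon>" if "A \<in> space ?M" for A
  proof -
    note dom = space_eval_dom[OF that]
    note c = nc_alg_carrier[OF a dom] nc_alg_carrier[OF b dom]
    have "ntr (a (n, A) - b (n, A)) = ntr (a (n, A)) - ntr (b (n, A))"
      using c by (simp add: ntr_def sum_subtractf diff_divide_distrib)
    then have "\<bar>Re (ntr (a (n, A))) - Re (ntr (b (n, A)))\<bar> \<le> cmod (ntr (a (n, A) - b (n, A)))"
      using abs_Re_le_cmod[of "ntr (a (n, A) - b (n, A))"] by simp
    also have "\<dots> \<le> op_norm (a (n, A) - b (n, A))"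
      using c by (intro norm_ntr_le_op_norm[of _ n] minus_carrier_mat)
    also note ab[OF dom]
    finally show ?thesis .
  qed
  have "Re (gibbs_state N R h n a) - Re (gibbs_state N R h n b)
      = (LINT A|?M. ?d A * (Re (ntr (a (n, A))) - Re (ntr (b (n, A)))))"
    using int unfolding Re_gibbs_state[OF h a] Re_gibbs_state[OF h b] by (simp add: right_diff_distrib)
  also have "\<bar>\<dots>\<bar> \<le> (LINT A|?M. \<bar>?d A * (Re (ntr (a (n, A))) - Re (ntr (b (n, A))))\<bar>)"
    by (rule integral_abs_bound)
  also have "\<dots> \<le> (LINT A|?M. ?d A * \<epsilon>)"
  proof (rule integral_mono)
    have "integrable ?M (\<lambda>A. ?d A * (Re (ntr (a (n, A))) - Re (ntr (b (n, A)))))"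
      using int unfolding right_diff_distrib by (intro Bochner_Integration.integrable_diff) auto
    then show "integrable ?M (\<lambda>A. \<bar>?d A * (Re (ntr (a (n, A))) - Re (ntr (b (n, A))))\<bar>)"
      by (rule integrable_abs)
    show "integrable ?M (\<lambda>A. ?d A * \<epsilon>)" using int by simp
    fix A assume "A \<in> space ?M"
    from close[OF this] show "\<bar>?d A * (Re (ntr (a (n, A))) - Re (ntr (b (n, A))))\<bar> \<le> ?d A * \<epsilon>"
      using gibbs_density_pos[of h A] by (simp add: abs_mult mult_left_mono)
  qed
  also have "\<dots> = \<epsilon>" by (simp add: integral_gibbs_density[OF h])
  finally show ?thesis .
qed

text \<open>Each defining property holds for the normalized trace at every single tuple and survives
  integration against a probability density.\<close>

lemma gibbs_state_tracial:
  assumes h: "h \<in> nc_alg N R"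
  shows "gibbs_state N R h n \<in> tracial_states N R"
proof -
  let ?M = "Lambda_ball N R n" and ?\<mu> = "gibbs_state N R h n" and ?d = "gibbs_density N R h n"
  note dom = space_eval_dom
  have R0: "0 \<le> R" using R by simp
  have add: "?\<mu> (nc_add N R a b) = ?\<mu> a + ?\<mu> b" if a: "a \<in> nc_alg N R" and b: "b \<in> nc_alg N R" for a b
  proof -
    have "ntr (nc_add N R a b (n, A)) = ntr (a (n, A)) + ntr (b (n, A))" if "A \<in> space ?M" for A
      using dom[OF that] by (simp add: nc_add_def ntr_add[OF nc_alg_carrier[OF a] nc_alg_carrier[OF b]])
    then have "(LINT A|?M. complex_of_real (?d A) * ntr (nc_add N R a b (n, A)))
        = (LINT A|?M. complex_of_real (?d A) * ntr (a (n, A)) + complex_of_real (?d A) * ntr (b (n, A)))"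
      by (intro Bochner_Integration.integral_cong) (auto simp: distrib_left)
    then show ?thesis
      using a b nc_add_nc_alg[OF a b] integrable_gibbs_ntr[OF h a] integrable_gibbs_ntr[OF h b]
      by (simp add: gibbs_state_def)
  qed
  have scale: "?\<mu> (nc_scale N R c a) = c * ?\<mu> a" if a: "a \<in> nc_alg N R" for a c
  proof -
    have "ntr (nc_scale N R c a (n, A)) = c * ntr (a (n, A))" if "A \<in> space ?M" for A
      using dom[OF that] nc_alg_carrier[OF a dom[OF that]] by (simp add: nc_scale_def ntr_smult)
    then have "(LINT A|?M. complex_of_real (?d A) * ntr (nc_scale N R c a (n, A)))
        = (LINT A|?M. c * (complex_of_real (?d A) * ntr (a (n, A))))"
      by (intro Bochner_Integration.integral_cong) auto
    then show ?thesis using a nc_scale_nc_alg[OF a] by (simp add: gibbs_state_def)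
  qed
  have pos: "?\<mu> (nc_mult N R (nc_star N R a) a) \<in> \<real> \<and> 0 \<le> Re (?\<mu> (nc_mult N R (nc_star N R a) a))"
    if a: "a \<in> nc_alg N R" for a
  proof -
    let ?s = "\<lambda>A. (\<Sum>i<n. \<Sum>l<n. (cmod (a (n, A) $$ (l, i)))\<^sup>2) / n"
    have "ntr (nc_mult N R (nc_star N R a) a (n, A)) = of_real (?s A)" if "A \<in> space ?M" for A
      using dom[OF that] ntr_adjoint_mult[OF nc_alg_carrier[OF a dom[OF that]]]
      by (simp add: nc_mult_def nc_star_def)
    then have "(LINT A|?M. complex_of_real (?d A) * ntr (nc_mult N R (nc_star N R a) a (n, A)))
        = (LINT A|?M. complex_of_real (?d A * ?s A))"
      by (intro Bochner_Integration.integral_cong) auto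
    also have "\<dots> = complex_of_real (LINT A|?M. ?d A * ?s A)"
      by (rule integral_complex_of_real)
    finally have "?\<mu> (nc_mult N R (nc_star N R a) a) = complex_of_real (LINT A|?M. ?d A * ?s A)"
      using nc_mult_nc_alg[OF nc_star_nc_alg[OF a] a R0] by (simp add: gibbs_state_def)
    moreover have "0 \<le> (LINT A|?M. ?d A * ?s A)"
      using gibbs_density_pos[of h]
      by (intro integral_nonneg mult_nonneg_nonneg divide_nonneg_nonneg sum_nonneg) (auto simp: less_imp_le)
    ultimately show ?thesis by simp
  qed
  have one: "?\<mu> (nc_one N R) = 1"
  proof -
    have "ntr (nc_one N R (n, A)) = 1" if "A \<in> space ?M" for A
      using dom[OF that] n by (simp add: nc_one_def ntr_one)
    then have "(LINT A|?M. complex_of_real (?d A) * ntr (nc_one N R (n, A)))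
        = (LINT A|?M. complex_of_real (?d A))"
      by (intro Bochner_Integration.integral_cong) auto
    then show ?thesis
      using nc_one_nc_alg by (simp add: gibbs_state_def integral_gibbs_density[OF h])
  qed
  have trace: "?\<mu> (nc_mult N R a b) = ?\<mu> (nc_mult N R b a)"
    if a: "a \<in> nc_alg N R" and b: "b \<in> nc_alg N R" for a b
  proof -
    have "ntr (nc_mult N R a b (n, A)) = ntr (nc_mult N R b a (n, A))" if "A \<in> space ?M" for A
      using dom[OF that] ntr_mult_commute[OF nc_alg_carrier[OF a dom[OF that]] nc_alg_carrier[OF b dom[OF that]]]
      by (simp add: nc_mult_def)
    then have "(LINT A|?M. complex_of_real (?d A) * ntr (nc_mult N R a b (n, A)))
        = (LINT A|?M. complex_of_real (?d A) * ntr (nc_mult N R b a (n, A)))"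
      by (intro Bochner_Integration.integral_cong) auto
    then show ?thesis
      using nc_mult_nc_alg[OF a b R0] nc_mult_nc_alg[OF b a R0] by (simp add: gibbs_state_def)
  qed
  show ?thesis
    unfolding tracial_states_def using add scale pos one trace
    by (auto simp: gibbs_state_def)
qed

text \<open>The logarithm of the Gibbs density is minus the pressure minus
  \<open>(real n)\<^sup>2\<close> times the real part of the trace; integrating it against the
  density produces the mean of \<open>h\<close>. The Radon-Nikodym derivative agrees with the
  explicit density only almost everywhere, which is enough under the integral.\<close>

lemma entropy_seq_eq:
  assumes h: "h \<in> nc_alg N R"
  shows "entropy_seq N R h n = pressure_seq N R h n + Re (gibbs_state N R h n h)"
proof -
  let ?M = "Lambda_ball N R n" and ?d = "gibbs_density N R h n" and ?P = "pressure N R n h"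
  let ?t = "\<lambda>A. Re (ntr (h (n, A)))"
  note [measurable] = measurable_gibbs_density[OF h]
  have "AE A in ?M. ennreal (?d A) = RN_deriv ?M (gibbs N R n h) A"
    by (rule RN_deriv_unique) (measurable, simp add: gibbs_def gibbs_density_def[abs_def])
  then have ae: "AE A in ?M. enn2real (RN_deriv ?M (gibbs N R n h) A) = ?d A"
    by eventually_elim (metis enn2real_ennreal gibbs_density_pos less_imp_le)
  have "(LINT A|?M. enn2real (RN_deriv ?M (gibbs N R n h) A) * ln (enn2real (RN_deriv ?M (gibbs N R n h) A)))
      = (LINT A|?M. ?d A * ln (?d A))"
    by (rule integral_cong_AE) (use ae in auto)
  also have "\<dots> = (LINT A|?M. (- ?P) * ?d A - (real n)\<^sup>2 * (?d A * ?t A))"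
    by (intro Bochner_Integration.integral_cong refl)
      (simp add: gibbs_density_def gibbs_weight_def ln_mult algebra_simps)
  also have "\<dots> = - ?P - (real n)\<^sup>2 * Re (gibbs_state N R h n h)"
    using integrable_gibbs_density[OF h] integrable_gibbs_Re_ntr[OF h h]
    by (simp add: integral_gibbs_density[OF h] Re_gibbs_state[OF h h])
  finally have "bg_entropy ?M (gibbs N R n h) = ?P + (real n)\<^sup>2 * Re (gibbs_state N R h n h)"
    by (simp add: bg_entropy_def)
  then show ?thesis using n by (simp add: entropy_seq_def pressure_seq_def add_divide_distrib)
qed

text \<open>Jensen's inequality for the exponential function, in the form of its tangent at the mean \<open>m\<close>.\<close>

lemma gibbs_variational:
  assumes h: "h \<in> nc_alg N R" and k: "k \<in> nc_alg N R"
  shows "pressure_seq N R h n + Re (gibbs_state N R h n h)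
    \<le> pressure_seq N R k n + Re (gibbs_state N R h n k)"
proof -
  let ?M = "Lambda_ball N R n" and ?d = "gibbs_density N R h n"
  \<comment> \<open>\<open>x\<close> is the exponent that turns the weight of \<open>h\<close> into
    the weight of \<open>k\<close>; \<open>m\<close> is its mean under the Gibbs measure of
    \<open>h\<close>.\<close>
  define x where "x A = (real n)\<^sup>2 * Re (ntr (h (n, A))) - (real n)\<^sup>2 * Re (ntr (k (n, A)))" for A
  define m where "m = (real n)\<^sup>2 * Re (gibbs_state N R h n h) - (real n)\<^sup>2 * Re (gibbs_state N R h n k)"
  note int = integrable_gibbs_density[OF h] integrable_gibbs_Re_ntr[OF h h] integrable_gibbs_Re_ntr[OF h k]
  have dx: "?d A * x A = (real n)\<^sup>2 * (?d A * Re (ntr (h (n, A)))) - (real n)\<^sup>2 * (?d A * Re (ntr (k (n, A))))" for A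
    by (simp add: x_def algebra_simps)
  have int_dx: "integrable ?M (\<lambda>A. ?d A * x A)"
    unfolding dx using int by (intro Bochner_Integration.integrable_diff integrable_mult_right) auto
  have m: "(LINT A|?M. ?d A * x A) = m"
    unfolding dx m_def Re_gibbs_state[OF h h] Re_gibbs_state[OF h k] using int by simp
  have eq: "exp (- pressure N R n h) * gibbs_weight k n A = ?d A * exp (x A)" for A
    by (simp add: gibbs_density_def gibbs_weight_def x_def flip: exp_add)
  \<comment> \<open>Since \<open>m\<close> is the mean of \<open>x\<close>, the linear part of the
    tangent integrates to zero and only \<open>exp m\<close> remains.\<close>
  have "(LINT A|?M. exp m * (1 - m) * ?d A + exp m * (?d A * x A)) = exp m * (1 - m) + exp m * m"
    using int int_dx by (simp add: m integral_gibbs_density[OF h])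
  then have "exp m = (LINT A|?M. exp m * (1 - m) * ?d A + exp m * (?d A * x A))"
    by (simp add: algebra_simps)
  also have "\<dots> \<le> (LINT A|?M. exp (- pressure N R n h) * gibbs_weight k n A)"
  proof (rule integral_mono)
    show "integrable ?M (\<lambda>A. exp m * (1 - m) * ?d A + exp m * (?d A * x A))"
      using int int_dx by (intro Bochner_Integration.integrable_add integrable_mult_right) auto
    show "integrable ?M (\<lambda>A. exp (- pressure N R n h) * gibbs_weight k n A)"
      using integrable_gibbs_weight[OF k] by simp
    fix A
    have "exp m * (1 + (x A - m)) \<le> exp m * exp (x A - m)"
      by (intro mult_left_mono exp_ge_add_one_self) auto
    then have "exp m * (1 - m) + exp m * x A \<le> exp (x A)"
      by (simp add: algebra_simps flip: exp_add)
    then have "?d A * (exp m * (1 - m) + exp m * x A) \<le> ?d A * exp (x A)"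
      using gibbs_density_pos[of h A] by (intro mult_left_mono) auto
    then show "exp m * (1 - m) * ?d A + exp m * (?d A * x A) \<le> exp (- pressure N R n h) * gibbs_weight k n A"
      unfolding eq by (simp add: algebra_simps)
  qed
  \<comment> \<open>The constant factor is the inverse of the partition function of
    \<open>h\<close>, so the integral is the quotient of the two partition functions.\<close>
  also have "\<dots> = exp (pressure N R n k - pressure N R n h)"
    by (simp add: exp_pressure[OF k, symmetric] flip: exp_add)
  finally have "pressure N R n h + m \<le> pressure N R n k" by simp
  then have "(pressure N R n h + m) / (real n)\<^sup>2 \<le> pressure N R n k / (real n)\<^sup>2"
    by (intro divide_right_mono) auto
  moreover have "(pressure N R n h + m) / (real n)\<^sup>2
      = pressure N R n h / (real n)\<^sup>2 + Re (gibbs_state N R h n h) - Re (gibbs_state N R h n k)"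
    using n by (simp add: m_def field_simps)
  ultimately show ?thesis by (simp add: pressure_seq_def)
qed

end

section \<open>Limits of Gibbs states\<close>

text \<open>Compactness gives a cluster point of the image filter. Intersecting \<open>F\<close>
  with the pullback of its neighbourhoods forces convergence, and clustering says precisely that
  this intersection is proper.\<close>

lemma compact_cluster_filter:
  fixes X :: "'b \<Rightarrow> 'a :: topological_space"
  assumes "compact K" "F \<noteq> bot" "eventually (\<lambda>k. X k \<in> K) F"
  obtains x G where "G \<le> F" "G \<noteq> bot" "(X \<longlongrightarrow> x) G"
proof -
  have "filtermap X F \<noteq> bot" "eventually (\<lambda>y. y \<in> K) (filtermap X F)"
    using assms by (auto simp: filtermap_bot_iff eventually_filtermap)
  then obtain x where x: "inf (nhds x) (filtermap X F) \<noteq> bot"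
    using \<open>compact K\<close> unfolding compact_filter by blast
  define G where "G = inf F (filtercomap X (nhds x))"
  have "G \<noteq> bot"
  proof
    assume "G = bot"
    then have "eventually (\<lambda>_. False) G" by simp
    then obtain P Q where P: "eventually P F" and Q: "eventually Q (filtercomap X (nhds x))"
      and PQ: "\<And>k. P k \<Longrightarrow> Q k \<Longrightarrow> False"
      unfolding G_def eventually_inf by blast
    obtain S where S: "eventually S (nhds x)" "\<And>k. S (X k) \<Longrightarrow> Q k"
      using Q by (auto simp: eventually_filtercomap)
    \<comment> \<open>On \<open>P\<close> the condition \<open>S\<close> must fail, although it
      holds near \<open>x\<close>; that contradicts clustering.\<close>
    have "eventually (\<lambda>y. \<not> S y) (filtermap X F)"
      unfolding eventually_filtermap using P by eventually_elim (use PQ S(2) in blast)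
    with S(1) have "eventually (\<lambda>_. False) (inf (nhds x) (filtermap X F))"
      unfolding eventually_inf by blast
    then show False using x by (simp add: trivial_limit_def)
  qed
  moreover have "G \<le> F" by (simp add: G_def)
  moreover have "(X \<longlongrightarrow> x) G"
    unfolding G_def by (rule filterlim_mono[OF filterlim_filtercomap]) auto
  ultimately show ?thesis using that by blast
qed

lemma tendsto_apply:
  fixes X :: "'b \<Rightarrow> 'c \<Rightarrow> 'a :: topological_space"
  assumes "(X \<longlongrightarrow> x) F"
  shows "((\<lambda>k. X k a) \<longlongrightarrow> x a) F"
  using continuous_on_tendsto_compose[of UNIV "\<lambda>f. f a" X x F] assms
    continuous_on_product_then_coordinatewise[OF continuous_on_id, of UNIV a] by simp

section \<open>Limits along finer filters against liminf and limsup\<close>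

lemma Limsup_mono_filter: "G \<le> F \<Longrightarrow> Limsup G f \<le> Limsup F f"
  unfolding Limsup_def by (rule INF_superset_mono) (auto dest: filter_leD)

lemma Liminf_mono_filter: "G \<le> F \<Longrightarrow> Liminf F f \<le> Liminf G f"
  unfolding Liminf_def by (rule SUP_subset_mono) (auto dest: filter_leD)

text \<open>Passing to a subsequence and then to a finer filter can only lower a limsup. The filter
  lives on the indices of the subsequence. An inequality is assumed so that \<open>f\<close> may be
  a lower bound for the pressures of a competitor as well as the entropies themselves.\<close>

lemma le_limsup_of_subfilter:
  fixes f g :: "nat \<Rightarrow> ereal"
  assumes "strict_mono r" "G \<le> sequentially" "G \<noteq> bot" "(f \<longlongrightarrow> l) G"
    and "eventually (\<lambda>k. f k \<le> g (r k)) G"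
  shows "l \<le> limsup g"
proof -
  have "l = Limsup G f" using assms by (simp add: lim_imp_Limsup)
  also have "\<dots> \<le> Limsup G (g \<circ> r)" using assms by (intro Limsup_mono) simp
  also have "\<dots> \<le> limsup (g \<circ> r)" using assms by (intro Limsup_mono_filter)
  also have "\<dots> \<le> limsup g" using assms by (intro limsup_subseq_mono)
  finally show ?thesis .
qed

lemma liminf_le_of_subfilter:
  fixes f g :: "nat \<Rightarrow> ereal"
  assumes "strict_mono r" "G \<le> sequentially" "G \<noteq> bot" "((\<lambda>k. g (r k)) \<longlongrightarrow> l) G"
  shows "liminf g \<le> l"
proof -
  have "liminf g \<le> liminf (g \<circ> r)" using assms by (intro liminf_subseq_mono)
  also have "\<dots> \<le> Liminf G (g \<circ> r)" using assms by (intro Liminf_mono_filter)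
  also have "\<dots> = l" using assms by (simp add: lim_imp_Liminf comp_def)
  finally show ?thesis .
qed

text \<open>\<open>eval_dom\<close> starts in dimension 1, so elements of the algebra carry no
  information in dimension 0; the identities for Gibbs states become available once
  \<open>r k\<close> has left it.\<close>

lemma eventually_subseq_ge_1: "strict_mono (r :: nat \<Rightarrow> nat) \<Longrightarrow> eventually (\<lambda>k. r k \<ge> 1) sequentially"
  using eventually_ge_at_top[of 1] by eventually_elim (metis order_trans seq_suble)

section \<open>Cluster points of the Gibbs states\<close>

lemma nc_alg_sa_nc_alg: "h \<in> nc_alg_sa N R \<Longrightarrow> h \<in> nc_alg N R"
  by (simp add: nc_alg_sa_def)

lemma gibbs_states_cluster:
  assumes R: "R > 0" and h: "h \<in> nc_alg N R" and r: "strict_mono r"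
  obtains G \<mu> where "G \<le> sequentially" "G \<noteq> bot"
    "\<forall>a. ((\<lambda>k. gibbs_state N R h (r k) a) \<longlongrightarrow> \<mu> a) G"
proof -
  have "\<exists>C. \<forall>n A. (n, A) \<in> eval_dom N R \<longrightarrow> op_norm (a (n, A)) \<le> C" if "a \<in> nc_alg N R" for a
    using nc_alg_bounded[OF that] R by (metis less_imp_le)
  then obtain C where C: "\<And>a n A. a \<in> nc_alg N R \<Longrightarrow> (n, A) \<in> eval_dom N R \<Longrightarrow> op_norm (a (n, A)) \<le> C a"
    by metis
  \<comment> \<open>Extensional functions equal \<open>undefined\<close> outside the algebra, which
    makes those factors singletons and hence compact.\<close>
  let ?S = "\<lambda>a. if a \<in> nc_alg N R then cball (0 :: complex) (C a) else {undefined}"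
  have "compactin (product_topology (\<lambda>_. euclidean) UNIV) (PiE UNIV ?S)"
    unfolding compactin_PiE by auto
  then have K: "compact (PiE UNIV ?S)"
    unfolding euclidean_product_topology by simp
  have "eventually (\<lambda>k. gibbs_state N R h (r k) \<in> PiE UNIV ?S) sequentially"
    using eventually_subseq_ge_1[OF r]
  proof eventually_elim
    case (elim k)
    have "cmod (gibbs_state N R h (r k) a) \<le> C a" if a: "a \<in> nc_alg N R" for a
      using elim C[OF a] by (intro norm_gibbs_state_le[OF R elim h a]) (auto simp: eval_dom_iff)
    then show ?case by (auto simp: PiE_iff gibbs_state_def)
  qed
  from compact_cluster_filter[OF K sequentially_bot this] obtain \<mu> G
    where G: "G \<le> sequentially" "G \<noteq> bot" "((\<lambda>k. gibbs_state N R h (r k)) \<longlongrightarrow> \<mu>) G"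
    by blast
  show ?thesis by (rule that[OF G(1,2), of \<mu>]) (intro allI tendsto_apply[OF G(3)])
qed

text \<open>Each condition is an equation or a non-strict inequality between continuous expressions
  in finitely many values of the state; such conditions survive pointwise limits along any proper
  filter.\<close>

lemma tracial_states_closed:
  assumes G: "G \<noteq> bot" and lim: "\<And>a. ((\<lambda>k. X k a) \<longlongrightarrow> \<mu> a) G"
    and ev: "eventually (\<lambda>k. X k \<in> tracial_states N R) G"
  shows "\<mu> \<in> tracial_states N R"
proof -
  have eqI: "x = y" if "(f \<longlongrightarrow> x) G" "(g \<longlongrightarrow> y) G" "eventually (\<lambda>k. f k = g k) G"
    for x y :: complex and f g :: "'a \<Rightarrow> complex"
    using tendsto_unique[OF G] that tendsto_cong by metis
  have "\<mu> a = undefined" if "a \<notin> nc_alg N R" for a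
    by (rule eqI[OF lim tendsto_const])
      (use ev in \<open>eventually_elim, use that in \<open>auto simp: tracial_states_def extensional_def\<close>\<close>)
  moreover have "\<mu> (nc_add N R a b) = \<mu> a + \<mu> b" if "a \<in> nc_alg N R" "b \<in> nc_alg N R" for a b
    by (rule eqI[OF lim tendsto_add[OF lim lim]])
      (use ev in \<open>eventually_elim, use that in \<open>auto simp: tracial_states_def\<close>\<close>)
  moreover have "\<mu> (nc_scale N R c a) = c * \<mu> a" if "a \<in> nc_alg N R" for a c
    by (rule eqI[OF lim tendsto_mult[OF tendsto_const lim]])
      (use ev in \<open>eventually_elim, use that in \<open>auto simp: tracial_states_def\<close>\<close>)
  moreover have "\<mu> (nc_mult N R (nc_star N R a) a) \<in> \<real>" if "a \<in> nc_alg N R" for a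
  proof -
    \<comment> \<open>Being real is rephrased as an equation for the imaginary part, to which
      uniqueness of limits applies.\<close>
    have "complex_of_real (Im (\<mu> (nc_mult N R (nc_star N R a) a))) = 0"
      by (rule eqI[OF tendsto_of_real[OF tendsto_Im[OF lim]] tendsto_const])
        (use ev in \<open>eventually_elim, use that in \<open>auto simp: tracial_states_def complex_is_Real_iff\<close>\<close>)
    then show ?thesis by (simp add: complex_is_Real_iff)
  qed
  moreover have "0 \<le> Re (\<mu> (nc_mult N R (nc_star N R a) a))" if "a \<in> nc_alg N R" for a
    by (rule tendsto_lowerbound[OF tendsto_Re[OF lim] _ G])
      (use ev in \<open>eventually_elim, use that in \<open>auto simp: tracial_states_def\<close>\<close>)
  moreover have "\<mu> (nc_one N R) = 1"
    by (rule eqI[OF lim tendsto_const])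
      (use ev in \<open>eventually_elim, auto simp: tracial_states_def\<close>)
  moreover have "\<mu> (nc_mult N R a b) = \<mu> (nc_mult N R b a)" if "a \<in> nc_alg N R" "b \<in> nc_alg N R" for a b
    by (rule eqI[OF lim lim])
      (use ev in \<open>eventually_elim, use that in \<open>auto simp: tracial_states_def\<close>\<close>)
  ultimately show ?thesis by (auto simp: tracial_states_def extensional_def)
qed

text \<open>The variational inequality for the Gibbs state of \<open>k\<close> bounds the pressure
  of \<open>k\<close> by that of \<open>h\<close> plus the mean of \<open>h - k\<close>, which is at
  most \<epsilon>, in every positive dimension.\<close>

lemma free_pressure_approx:
  assumes R: "R > 0" and h: "h \<in> nc_alg N R" and k: "k \<in> nc_alg N R"
    and close: "\<And>n A. (n, A) \<in> eval_dom N R \<Longrightarrow> op_norm (h (n, A) - k (n, A)) \<le> \<epsilon>"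
  shows "free_pressure N R k \<le> free_pressure N R h + ereal \<epsilon>"
proof -
  obtain s where s: "strict_mono s"
    "((\<lambda>n. ereal (pressure_seq N R k n)) \<circ> s) \<longlonglongrightarrow> free_pressure N R k"
    unfolding free_pressure_def using limsup_subseq_lim by blast
  \<comment> \<open>Moving \<epsilon> to the left keeps the right side a bare pressure, whose limsup
    is the free pressure.\<close>
  have "((\<lambda>m. ereal (pressure_seq N R k (s m)) + ereal (- \<epsilon>)) \<longlongrightarrow> free_pressure N R k + ereal (- \<epsilon>)) sequentially"
    using s(2) by (intro tendsto_add_ereal_general1 tendsto_const) (simp_all add: comp_def)
  moreover have "eventually (\<lambda>m. ereal (pressure_seq N R k (s m)) + ereal (- \<epsilon>) \<le> ereal (pressure_seq N R h (s m))) sequentially"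
    using eventually_subseq_ge_1[OF s(1)]
  proof eventually_elim
    case (elim m)
    have "\<bar>Re (gibbs_state N R k (s m) h) - Re (gibbs_state N R k (s m) k)\<bar> \<le> \<epsilon>"
      using close by (intro Re_gibbs_state_le[OF R elim k h k])
    then show ?case using gibbs_variational[OF R elim k h] by simp
  qed
  ultimately have "free_pressure N R k + ereal (- \<epsilon>) \<le> free_pressure N R h"
    unfolding free_pressure_def[of N R h] by (intro le_limsup_of_subfilter[OF s(1), of sequentially]) auto
  then show ?thesis by (cases "free_pressure N R k"; cases "free_pressure N R h") auto
qed

text \<open>Infinite values of the free pressure cause no harm: every limit below adds a finite number
  to the pressure.\<close>

lemma equilibrium_state_of_subsequence:
  assumes R: "R > 0" and h: "h \<in> nc_alg_sa N R" and r: "strict_mono r"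
    and lim_p: "(\<lambda>k. ereal (pressure_seq N R h (r k))) \<longlonglongrightarrow> free_pressure N R h"
  obtains \<mu> G where "\<mu> \<in> equilibrium_states N R h" "G \<le> sequentially" "G \<noteq> bot"
    "((\<lambda>k. ereal (entropy_seq N R h (r k))) \<longlongrightarrow> eta N R \<mu>) G"
proof -
  note ha = nc_alg_sa_nc_alg[OF h]
  let ?X = "\<lambda>k. gibbs_state N R h (r k)"
  obtain G \<mu> where G: "G \<le> sequentially" "G \<noteq> bot" and all: "\<forall>a. ((\<lambda>k. ?X k a) \<longlongrightarrow> \<mu> a) G"
    by (rule gibbs_states_cluster[OF R ha r])
  from all have lim: "((\<lambda>k. ?X k a) \<longlongrightarrow> \<mu> a) G" for a
    by (rule spec)
  have ev: "eventually (\<lambda>k. r k \<ge> 1) G"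
    using eventually_subseq_ge_1[OF r] G(1) by (rule filter_leD[rotated])
  have lim_p': "((\<lambda>k. ereal (pressure_seq N R h (r k))) \<longlongrightarrow> free_pressure N R h) G"
    using lim_p G(1) by (rule tendsto_mono[rotated])
  have "eventually (\<lambda>k. ?X k \<in> tracial_states N R) G"
    using ev by eventually_elim (rule gibbs_state_tracial[OF R _ ha])
  then have tracial: "\<mu> \<in> tracial_states N R"
    by (rule tracial_states_closed[OF G(2) lim])
  have lim_Re: "((\<lambda>k. ereal (Re (?X k a))) \<longlongrightarrow> ereal (Re (\<mu> a))) G" for a
    by (intro tendsto_intros lim)
  \<comment> \<open>The value that the equilibrium condition prescribes for \<open>eta\<close>. The
    entropies are shown to tend to it before \<open>eta\<close> is known to equal it.\<close>
  let ?T = "free_pressure N R h + ereal (Re (\<mu> h))"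
  have lim_e: "((\<lambda>k. ereal (entropy_seq N R h (r k))) \<longlongrightarrow> ?T) G"
  proof (rule Lim_transform_eventually)
    show "((\<lambda>k. ereal (pressure_seq N R h (r k)) + ereal (Re (?X k h))) \<longlongrightarrow> ?T) G"
      by (intro tendsto_add_ereal_general1 lim_p' lim_Re) simp
    show "eventually (\<lambda>k. ereal (pressure_seq N R h (r k)) + ereal (Re (?X k h)) = ereal (entropy_seq N R h (r k))) G"
      using ev by eventually_elim (simp add: entropy_seq_eq[OF R _ ha])
  qed
  have ge: "?T \<le> eta N R \<mu>"
    unfolding eta_def
  proof (rule INF_greatest)
    fix p assume "p \<in> ncpolys_sa N"
    then have p: "of_poly N R p \<in> nc_alg N R" by (simp add: ncpolys_sa_def of_poly_nc_alg)
    let ?p = "of_poly N R p"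
    \<comment> \<open>The two finite terms are first combined into one real number, so that the
      extended sum has at most one infinite summand.\<close>
    have "((\<lambda>k. ereal (pressure_seq N R h (r k)) + ereal (Re (?X k h) - Re (?X k ?p)))
        \<longlongrightarrow> free_pressure N R h + ereal (Re (\<mu> h) - Re (\<mu> ?p))) G"
      by (intro tendsto_add_ereal_general1 lim_p' tendsto_intros lim) simp
    moreover have "eventually (\<lambda>k. ereal (pressure_seq N R h (r k)) + ereal (Re (?X k h) - Re (?X k ?p))
        \<le> ereal (pressure_seq N R ?p (r k))) G"
      using ev
    proof eventually_elim
      case (elim k)
      then show ?case using gibbs_variational[OF R elim ha p] by simp
    qed
    ultimately have "free_pressure N R h + ereal (Re (\<mu> h) - Re (\<mu> ?p)) \<le> free_pressure N R ?p"
      unfolding free_pressure_def[of N R ?p] by (rule le_limsup_of_subfilter[OF r G])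
    then show "?T \<le> ereal (Re (\<mu> ?p)) + free_pressure N R ?p"
      by (cases "free_pressure N R h"; cases "free_pressure N R ?p") auto
  qed
  have le: "eta N R \<mu> \<le> ?T"
  proof (rule ereal_le_epsilon2)
    fix e :: real assume "0 < e"
    \<comment> \<open>One half pays for replacing \<open>h\<close> by \<open>p\<close> in the state,
      the other for the change of the free pressure.\<close>
    then have "0 < e / 2" by simp
    obtain p where p: "p \<in> ncpolys_sa N"
      "\<And>n A. (n, A) \<in> eval_dom N R \<Longrightarrow> op_norm (h (n, A) - eval_poly n A p) \<le> e / 2"
      using nc_alg_sa_approx[OF h \<open>0 < e / 2\<close>] by blast
    let ?p = "of_poly N R p"
    have pa: "?p \<in> nc_alg N R" using p(1) by (simp add: ncpolys_sa_def of_poly_nc_alg)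
    have close: "\<And>n A. (n, A) \<in> eval_dom N R \<Longrightarrow> op_norm (h (n, A) - ?p (n, A)) \<le> e / 2"
      using p(2) by (simp add: of_poly_def)
    have "Re (\<mu> ?p) - Re (\<mu> h) \<le> e / 2"
    proof (rule tendsto_upperbound[OF tendsto_diff[OF tendsto_Re[OF lim] tendsto_Re[OF lim]] _ G(2)])
      show "eventually (\<lambda>k. Re (?X k ?p) - Re (?X k h) \<le> e / 2) G"
        using ev
      proof eventually_elim
        case (elim k)
        have "\<bar>Re (?X k h) - Re (?X k ?p)\<bar> \<le> e / 2"
          using close by (intro Re_gibbs_state_le[OF R elim ha ha pa])
        then show ?case by linarith
      qed
    qed
    then have "eta N R \<mu> \<le> ereal (Re (\<mu> h) + e / 2) + (free_pressure N R h + ereal (e / 2))"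
      unfolding eta_def using free_pressure_approx[OF R ha pa close]
      by (intro INF_lower2[OF p(1)] add_mono) auto
    also have "\<dots> = ?T + ereal e" by (cases "free_pressure N R h") auto
    finally show "eta N R \<mu> \<le> ?T + ereal e" .
  qed
  from ge le have eta: "eta N R \<mu> = ?T" by simp
  have "free_pressure N R h = - ereal (Re (\<mu> h)) + eta N R \<mu>"
    unfolding eta by (cases "free_pressure N R h") auto
  with tracial have "\<mu> \<in> equilibrium_states N R h" by (simp add: equilibrium_states_def)
  moreover have "((\<lambda>k. ereal (entropy_seq N R h (r k))) \<longlongrightarrow> eta N R \<mu>) G" using lim_e eta by simp
  ultimately show ?thesis using that G by blast
qed

theorem proposition7p2:
  fixes N :: nat and R :: real and h\<^sub>0 :: ncfun
  assumes "R > 0" and "h\<^sub>0 \<in> nc_alg_sa N R"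
  shows
    "(\<exists>\<mu>\<^sub>0 \<in> equilibrium_states N R h\<^sub>0.
        liminf (\<lambda>n. ereal (entropy_seq N R h\<^sub>0 n)) \<le> eta N R \<mu>\<^sub>0 \<and>
        eta N R \<mu>\<^sub>0 \<le> limsup (\<lambda>n. ereal (entropy_seq N R h\<^sub>0 n))) \<and>
     ((\<lambda>n. ereal (pressure_seq N R h\<^sub>0 n)) \<longlonglongrightarrow> free_pressure N R h\<^sub>0 \<longrightarrow>
        (\<forall>l. (\<exists>r. strict_mono r \<and> (\<lambda>k. ereal (entropy_seq N R h\<^sub>0 (r k))) \<longlonglongrightarrow> l) \<longrightarrow>
             (\<exists>\<mu>\<^sub>0 \<in> equilibrium_states N R h\<^sub>0. eta N R \<mu>\<^sub>0 = l)) \<and>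
        (\<forall>\<mu>\<^sub>0. equilibrium_states N R h\<^sub>0 = {\<mu>\<^sub>0} \<longrightarrow>
             (\<lambda>n. ereal (entropy_seq N R h\<^sub>0 n)) \<longlonglongrightarrow> eta N R \<mu>\<^sub>0))"
proof (intro conjI impI allI)
  let ?S = "\<lambda>n. ereal (entropy_seq N R h\<^sub>0 n)"
  obtain r where r: "strict_mono r"
    "((\<lambda>n. ereal (pressure_seq N R h\<^sub>0 n)) \<circ> r) \<longlonglongrightarrow> free_pressure N R h\<^sub>0"
    unfolding free_pressure_def using limsup_subseq_lim by blast
  obtain \<mu> G where \<mu>: "\<mu> \<in> equilibrium_states N R h\<^sub>0" and G: "G \<le> sequentially" "G \<noteq> bot"
    and lim: "((\<lambda>k. ?S (r k)) \<longlongrightarrow> eta N R \<mu>) G"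
    using equilibrium_state_of_subsequence[OF assms r(1)] r(2) by (auto simp: comp_def)
  have "liminf ?S \<le> eta N R \<mu>"
    by (rule liminf_le_of_subfilter[OF r(1) G lim])
  moreover have "eta N R \<mu> \<le> limsup ?S"
    by (rule le_limsup_of_subfilter[OF r(1) G lim]) simp
  ultimately show "\<exists>\<mu>\<^sub>0 \<in> equilibrium_states N R h\<^sub>0. liminf ?S \<le> eta N R \<mu>\<^sub>0 \<and> eta N R \<mu>\<^sub>0 \<le> limsup ?S"
    using \<mu> by blast
next
  let ?S = "\<lambda>n. ereal (entropy_seq N R h\<^sub>0 n)"
  assume p: "(\<lambda>n. ereal (pressure_seq N R h\<^sub>0 n)) \<longlonglongrightarrow> free_pressure N R h\<^sub>0"
  have limit_point: "\<exists>\<mu>\<^sub>0 \<in> equilibrium_states N R h\<^sub>0. eta N R \<mu>\<^sub>0 = l"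
    if r: "strict_mono r" "(\<lambda>k. ?S (r k)) \<longlonglongrightarrow> l" for l r
  proof -
    \<comment> \<open>Convergence of the full sequence of pressures is inherited by
      \<open>r\<close>, although \<open>r\<close> was chosen for the entropies alone.\<close>
    have "(\<lambda>k. ereal (pressure_seq N R h\<^sub>0 (r k))) \<longlonglongrightarrow> free_pressure N R h\<^sub>0"
      using LIMSEQ_subseq_LIMSEQ[OF p r(1)] by (simp add: comp_def)
    then obtain \<mu> G where \<mu>: "\<mu> \<in> equilibrium_states N R h\<^sub>0" and G: "G \<le> sequentially" "G \<noteq> bot"
      and lim: "((\<lambda>k. ?S (r k)) \<longlongrightarrow> eta N R \<mu>) G"
      using equilibrium_state_of_subsequence[OF assms r(1)] by blast
    \<comment> \<open>The entropies converge to \<open>l\<close> along all of \<open>r\<close>,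
      hence also along the finer filter.\<close>
    have "eta N R \<mu> = l"
      using tendsto_unique[OF G(2) lim tendsto_mono[OF G(1) r(2)]] .
    then show ?thesis using \<mu> by blast
  qed
  show "\<exists>\<mu>\<^sub>0 \<in> equilibrium_states N R h\<^sub>0. eta N R \<mu>\<^sub>0 = l"
    if "\<exists>r. strict_mono r \<and> (\<lambda>k. ?S (r k)) \<longlonglongrightarrow> l" for l
    using that limit_point by blast
  show "?S \<longlonglongrightarrow> eta N R \<mu>\<^sub>0" if unique: "equilibrium_states N R h\<^sub>0 = {\<mu>\<^sub>0}" for \<mu>\<^sub>0
  proof -
    \<comment> \<open>Both extremes are limit points in the extended reals, finite or not, so both
      are values of \<open>eta\<close> at the only equilibrium state and therefore agree.\<close>
    obtain r s where "strict_mono r" "(?S \<circ> r) \<longlonglongrightarrow> liminf ?S" "strict_mono s" "(?S \<circ> s) \<longlonglongrightarrow> limsup ?S"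
      using limsup_subseq_lim liminf_subseq_lim by metis
    then have "liminf ?S = eta N R \<mu>\<^sub>0" "limsup ?S = eta N R \<mu>\<^sub>0"
      using limit_point[of r "liminf ?S"] limit_point[of s "limsup ?S"] unique by (auto simp: comp_def)
    then show ?thesis by (intro Liminf_eq_Limsup) auto
  qed
qed

end
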